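(* For every prime $p \ge 3$ there exists a constant $C = C(p) > 0$ such that for every $0 < \mu < 1$ there exists $n_0 = n_0(p,\mu)$ such that for all $n \ge n_0$ the following holds. Let $X^{(1)},\ldots,X^{(p)} \in \mathbb{F}_p^n$ be a uniformly random arithmetic progression of length $p$. If $S^{(1)},\ldots,S^{(p)}$ are symmetric subsets of $\mathbb{F}_p^n$ satisfying $$\Pr\left[X^{(1)}\in S^{(1)}\land\ldots\land X^{(p)}\in S^{(p)}\right] < \mu^C ,$$ then there exist symmetric sets $S'^{(1)},\ldots,S'^{(p)}\subseteq\mathbb{F}_p^n$, each of density at most $\mu$, such that, letting $T^{(j)} := S^{(j)}\setminus S'^{(j)}$ for $j=1,\ldots,p$, we have $$\Pr\left[X^{(1)}\in T^{(1)}\land\ldots\land X^{(p)}\in T^{(p)}\right]=0 .$$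
   Context: For $x \in \mathbb{F}_p^n$ and $a \in \mathbb{F}_p$ let $w_a(x) := |\{i \in [n]: x_i = a\}|$. A set $S \subseteq \mathbb{F}_p^n$ is symmetric if membership $x \in S$ depends only on the weight tuple $(w_0(x),\ldots,w_{p-1}(x))$ (equivalently, $S$ is invariant under permutations of coordinates). The density of $S\subseteq\mathbb{F}_p^n$ is $|S|/p^n$. A uniformly random arithmetic progression of length $p$ in $\mathbb{F}_p^n$ is $X^{(j)} = X + (j-1)D$, $j=1,\ldots,p$, where $(X,D)$ is uniform in $\mathbb{F}_p^n\times\mathbb{F}_p^n$. Equivalently, the tuples $(X_i^{(1)},\ldots,X_i^{(p)})$, $i=1,\ldots,n$, are independent, each uniform among the $p^2$ progressions $x,x+d,\ldots,x+(p-1)d$ with $x,d\in\mathbb{F}_p$ (difference $d=0$ allowed). *)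

theory Defs
  imports "HOL-Probability.Probability" "HOL-Number_Theory.Residues"
begin

text \<open>Vectors over the prime field are extensional functions on \<open>{..<n}\<close> with values in
  \<open>residue_ring (int p)\<close>, whose carrier is \<open>{0..int p - 1}\<close>.\<close>

definition Fp_vec :: "nat \<Rightarrow> nat \<Rightarrow> (nat \<Rightarrow> int) set" where
  "Fp_vec p n = {..<n} \<rightarrow>\<^sub>E carrier (residue_ring (int p))"

definition weight :: "nat \<Rightarrow> int \<Rightarrow> (nat \<Rightarrow> int) \<Rightarrow> nat" where
  "weight n a x = card {i \<in> {..<n}. x i = a}"

definition symmetric_set :: "nat \<Rightarrow> nat \<Rightarrow> (nat \<Rightarrow> int) set \<Rightarrow> bool" where
  "symmetric_set p n S \<longleftrightarrow> S \<subseteq> Fp_vec p n \<and>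
     (\<forall>x \<in> Fp_vec p n. \<forall>y \<in> Fp_vec p n.
        (\<forall>a \<in> carrier (residue_ring (int p)). weight n a x = weight n a y) \<longrightarrow>
        (x \<in> S \<longleftrightarrow> y \<in> S))"

definition set_density :: "nat \<Rightarrow> nat \<Rightarrow> (nat \<Rightarrow> int) set \<Rightarrow> real" where
  "set_density p n S = real (card S) / real p ^ n"

text \<open>For \<open>1 \<le> j \<le> p\<close> the integer \<open>int j - 1\<close> is its own representative in the field.\<close>

definition ap_term :: "nat \<Rightarrow> nat \<Rightarrow> (nat \<Rightarrow> int) \<Rightarrow> (nat \<Rightarrow> int) \<Rightarrow> nat \<Rightarrow> (nat \<Rightarrow> int)" where
  "ap_term p n x d j =
     (\<lambda>i\<in>{..<n}. x i \<oplus>\<^bsub>residue_ring (int p)\<^esub> ((int j - 1) \<otimes>\<^bsub>residue_ring (int p)\<^esub> d i))"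

text \<open>A progression is the function taking \<open>j\<close> to its \<open>j\<close>-th term; only \<open>j \<in> {1..p}\<close> is
  meaningful.\<close>

definition random_ap :: "nat \<Rightarrow> nat \<Rightarrow> (nat \<Rightarrow> nat \<Rightarrow> int) pmf" where
  "random_ap p n =
     map_pmf (\<lambda>(x, d). ap_term p n x d) (pmf_of_set (Fp_vec p n \<times> Fp_vec p n))"

text \<open>\<open>pmf_of_set\<close> is the uniform distribution only on a finite nonempty set.\<close>

lemma finite_Fp_vec: "finite (Fp_vec p n)"
  by (simp add: Fp_vec_def residue_ring_def finite_PiE)

lemma Fp_vec_nonempty: "p > 0 \<Longrightarrow> Fp_vec p n \<noteq> {}"
  by (simp add: Fp_vec_def residue_ring_def PiE_eq_empty_iff)

lemma card_Fp_vec: "card (Fp_vec p n) = p ^ n"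
  by (simp add: Fp_vec_def residue_ring_def card_PiE)

end

theory Submission
  imports Defs
begin

text \<open>A progression is described by the counts \<open>N (x, d)\<close> of the coordinates carrying the one-dimensional
  progression \<open>(x, d)\<close>; the weights of its \<open>j\<close>-th term are the sums of \<open>N\<close> over the lines
  \<open>x + (j - 1) d = a\<close> of the affine plane over the prime field. Lines of different directions meet in one point, so
  the only obstruction to prescribing the weights of all \<open>p\<close> terms freely lives modulo \<open>p\<close>: if
  the prescribed weights agree modulo \<open>p\<close> with those of some progression, a near-uniform \<open>N\<close> in the right
  class modulo \<open>p\<close> is corrected by functions constant on lines. Stirling's formula then shows that, within
  \<open>A \<surd>n\<close> of the mean, the \<open>p\<close> weight vectors behave like independent ones up to a factor
  \<open>exp (- O (A\<^sup>2))\<close>, and \<open>A\<^sup>2 = O (ln (1 / \<mu>))\<close> suffices by a Chernoff bound, so the loss is polynomial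
  in \<open>\<mu>\<close>. It remains to remove from each set those classes modulo \<open>p\<close> that have density at most
  \<open>\<mu> / p\<^sup>p\<close>. For \<open>\<mu>\<close> close to \<open>1\<close>, where a constant factor in the bound cannot be absorbed into the exponent,
  a union bound shows that one of the sets can be removed entirely.\<close>

section \<open>Sizes of weight classes\<close>

text \<open>The increment \<open>D\<close> of \<open>ln\<close> over \<open>[x, x + 1]\<close> is
  the integral of the convex function \<open>1 / t\<close>: the midpoint rule bounds it below and
  the trapezoidal rule above. Hence the Stirling error \<open>g\<close> decreases, by at most a
  telescoping amount.\<close>

lemma ln_fact_Suc_step:
  fixes m :: nat
  assumes "m \<ge> 1"
  defines "g \<equiv> \<lambda>m::nat. ln (fact m) - (m * ln m - m + ln m / 2 :: real)"
  shows "g (Suc m) \<le> g m" and "g (Suc m) \<ge> g m - (1 / (4 * m) - 1 / (4 * Suc m))"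
proof -
  define x where "x = real m"
  have x: "x \<ge> 1" using assms by (simp add: x_def)
  define D where "D = ln (x + 1) - ln x"
  have Sm: "real (Suc m) = x + 1" by (simp add: x_def)
  have lf: "ln (fact (Suc m) :: real) = ln (x + 1) + ln (fact m)"
    using ln_mult[of "x + 1" "fact m"] x by (simp add: Sm[symmetric] mult.commute)
  have step: "g (Suc m) - g m = 1 - (x + 1/2) * D"
    unfolding g_def lf Sm D_def x_def[symmetric] by (simp add: algebra_simps)
  have "2 / (2 * x + 1) \<le> D"
    using ln_inverse_approx_ge[of x "x + 1"] x by (simp add: D_def algebra_simps)
  hence "(x + 1/2) * (2 / (2 * x + 1)) \<le> (x + 1/2) * D"
    using x by (intro mult_left_mono) auto
  moreover have "(x + 1/2) * (2 / (2 * x + 1)) = 1" using x by (simp add: field_simps)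
  ultimately show "g (Suc m) \<le> g m" using step by linarith
  have "D \<le> (inverse x + inverse (x + 1)) / 2"
    using ln_inverse_approx_le[of x 1] x by (simp add: D_def)
  hence "(x + 1/2) * D \<le> (x + 1/2) * ((inverse x + inverse (x + 1)) / 2)"
    using x by (intro mult_left_mono) auto
  also have "\<dots> = 1 + (1 / (4 * x) - 1 / (4 * (x + 1)))"
    using x by (simp add: divide_simps) (simp add: algebra_simps)
  finally have upper: "(x + 1/2) * D \<le> 1 + (1 / (4 * x) - 1 / (4 * (x + 1)))" .
  thus "g (Suc m) \<ge> g m - (1 / (4 * m) - 1 / (4 * Suc m))"
  proof -
    have aux: "s = 1 - d \<Longrightarrow> d \<le> 1 + e \<Longrightarrow> - e \<le> s" for s d e :: real by linarith
    show ?thesis using aux[OF step upper] by (simp add: x_def algebra_simps)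
  qed
qed

text \<open>The error is \<open>1\<close> at \<open>m = 1\<close> and the telescoping decrements
  total at most \<open>1/4\<close>, so it stays between \<open>3/4\<close> and \<open>1\<close>.
  Only its boundedness matters later.\<close>

lemma ln_fact_bounds:
  fixes m :: nat
  assumes "m \<ge> 1"
  shows "ln (fact m) \<le> 1 + (m * ln m - m + ln m / 2 :: real)"
    and "ln (fact m) \<ge> (m * ln m - m + ln m / 2 :: real)"
proof -
  \<comment> \<open>The extra \<open>1 / (4 * m)\<close> is what each decrement consumes; with it
    the lower bound is an equality at \<open>m = 1\<close> and passes through the induction.\<close>
  have "ln (fact m) \<le> 1 + (m * ln m - m + ln m / 2 :: real) \<and>
        ln (fact m) \<ge> (m * ln m - m + ln m / 2 :: real) + 3/4 + 1 / (4 * m)"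
    using assms
  proof (induction m rule: nat_induct_at_least)
    case base
    show ?case by simp
  next
    case (Suc m)
    show ?case using Suc.IH ln_fact_Suc_step[OF Suc.hyps] by linarith
  qed
  thus "ln (fact m) \<le> 1 + (m * ln m - m + ln m / 2 :: real)"
    and "ln (fact m) \<ge> (m * ln m - m + ln m / 2 :: real)"
    by (auto intro: order_trans[rotated])
qed

section \<open>Multinomial counts\<close>

text \<open>With the residues as \<open>B\<close> this is a weight class of vectors; with pairs of
  residues it is a class of progressions. The same two size estimates therefore serve both sides of
  the comparison.\<close>

definition count_class :: "nat \<Rightarrow> 'b set \<Rightarrow> ('b \<Rightarrow> nat) \<Rightarrow> (nat \<Rightarrow> 'b) set" where
  "count_class n B N = {f \<in> {..<n} \<rightarrow>\<^sub>E B. \<forall>b\<in>B. card {i \<in> {..<n}. f i = b} = N b}"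

lemma finite_count_class: "finite B \<Longrightarrow> finite (count_class n B N)"
  unfolding count_class_def by (rule finite_subset[OF _ finite_PiE[of "{..<n}" "\<lambda>_. B"]]) auto

text \<open>Reading a map as the list of its values identifies the class with the permutations of a
  multiset, which gives the multinomial coefficient; the product form avoids division of
  naturals.\<close>

lemma card_count_class:
  assumes "finite B" and "(\<Sum>b\<in>B. N b) = n"
  shows "card (count_class n B N) * (\<Prod>b\<in>B. fact (N b)) = fact n"
proof -
  define M where "M = (\<Sum>b\<in>B. replicate_mset (N b) b)"
  have cM: "count M b = (if b \<in> B then N b else 0)" for b
    using assms(1) by (simp add: M_def count_sum sum.delta)
  have sM: "size M = n" using assms by (simp add: M_def)
  have setM: "set_mset M \<subseteq> B"
    using cM by (metis count_eq_zero_iff subsetI)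
  have "bij_betw (\<lambda>f. map f [0..<n]) (count_class n B N) (permutations_of_multiset M)"
  proof (rule bij_betwI')
    fix f g assume "f \<in> count_class n B N" "g \<in> count_class n B N"
    then have fg: "f \<in> {..<n} \<rightarrow>\<^sub>E B" "g \<in> {..<n} \<rightarrow>\<^sub>E B" by (auto simp: count_class_def)
    show "(map f [0..<n] = map g [0..<n]) = (f = g)"
    proof
      assume "map f [0..<n] = map g [0..<n]"
      hence "f i = g i" if "i \<in> {..<n}" for i using that by simp
      thus "f = g" by (rule PiE_ext[OF fg])
    qed simp
  next
    fix f assume f: "f \<in> count_class n B N"
    have "count (mset (map f [0..<n])) b = count M b" for b
    proof (cases "b \<in> B")
      case True
      have "count (mset (map f [0..<n])) b = card {i \<in> {..<n}. f i = b}"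
        unfolding count_mset count_list_eq_length_filter length_filter_conv_card
        by (auto intro!: arg_cong[of _ _ card])
      thus ?thesis using f True by (simp add: cM count_class_def)
    next
      case False
      have "b \<notin> set (map f [0..<n])" using f False by (auto simp: count_class_def PiE_iff)
      thus ?thesis using False cM by (metis count_eq_zero_iff set_mset_mset)
    qed
    hence "mset (map f [0..<n]) = M" by (rule multiset_eqI)
    thus "map f [0..<n] \<in> permutations_of_multiset M" by (simp add: permutations_of_multiset_def)
  next
    fix xs assume "xs \<in> permutations_of_multiset M"
    hence xs: "mset xs = M" by (simp add: permutations_of_multiset_def)
    hence len: "length xs = n" using sM by (metis size_mset)
    define f where "f = restrict ((!) xs) {..<n}"
    have m: "xs = map f [0..<n]"
      by (rule nth_equalityI) (auto simp: len f_def)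
    have "set xs \<subseteq> B" using xs setM by (metis set_mset_mset)
    hence "f \<in> {..<n} \<rightarrow>\<^sub>E B" using len by (auto simp: f_def)
    moreover have "card {i \<in> {..<n}. f i = b} = N b" if "b \<in> B" for b
    proof -
      have "count (mset xs) b = card {i \<in> {..<n}. f i = b}"
        unfolding count_mset count_list_eq_length_filter length_filter_conv_card
        by (auto simp: f_def len intro!: arg_cong[of _ _ card])
      thus ?thesis using that by (simp add: xs cM)
    qed
    ultimately show "\<exists>f\<in>count_class n B N. xs = map f [0..<n]"
      using m by (auto simp: count_class_def)
  qed
  hence "card (count_class n B N) = card (permutations_of_multiset M)"
    by (rule bij_betw_same_card)
  moreover have "(\<Prod>b\<in>set_mset M. fact (count M b) :: nat) = (\<Prod>b\<in>B. fact (N b))"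
    using assms(1) setM by (intro prod.mono_neutral_cong_left) (auto simp: cM not_in_iff)
  ultimately show ?thesis
    using card_permutations_of_multiset_aux[of M] sM by simp
qed

lemma ln_card_count_class:
  assumes "finite B" and "(\<Sum>b\<in>B. N b) = n"
  shows "card (count_class n B N) > 0"
    and "ln (card (count_class n B N)) = ln (fact n) - (\<Sum>b\<in>B. ln (fact (N b) :: real))"
proof -
  note c = card_count_class[OF assms]
  show pos: "card (count_class n B N) > 0"
    using c by (metis fact_nonzero gr0I mult_zero_left)
  have "real (card (count_class n B N)) * (\<Prod>b\<in>B. fact (N b)) = fact n"
    using arg_cong[OF c, of real] by (simp add: of_nat_prod)
  hence "ln (fact n :: real) = ln (real (card (count_class n B N)) * (\<Prod>b\<in>B. fact (N b)))" by simp
  also have "\<dots> = ln (card (count_class n B N)) + ln (\<Prod>b\<in>B. fact (N b) :: real)"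
    using pos by (intro ln_mult_pos) (auto intro!: prod_pos)
  also have "ln (\<Prod>b\<in>B. fact (N b) :: real) = (\<Sum>b\<in>B. ln (fact (N b) :: real))"
    using assms(1) by (intro ln_prod) auto
  finally show "ln (card (count_class n B N)) = ln (fact n) - (\<Sum>b\<in>B. ln (fact (N b) :: real))"
    by simp
qed

text \<open>In Stirling's formula, \<open>ln t \<le> t - 1\<close> with
  \<open>t = k * N b / n\<close> bounds the entropy loss by a chi-square sum. Deviations of size
  \<open>A * sqrt n\<close> thus cost only a factor depending on \<open>k\<close> and
  \<open>A\<close>, besides the usual power of \<open>n\<close>.\<close>

lemma count_class_lower:
  fixes A :: real
  assumes B: "finite B" "card B = k" "k > 0" and sum: "(\<Sum>b\<in>B. N b) = n"
    and N: "\<And>b. b \<in> B \<Longrightarrow> N b \<ge> 1" "\<And>b. b \<in> B \<Longrightarrow> \<bar>N b - real n / k\<bar> \<le> A * sqrt n"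
  shows "ln (card (count_class n B N)) \<ge> n * ln (real k) - real k - (real k)\<^sup>2 * A\<^sup>2 - (real k - 1) / 2 * ln n"
proof -
  have Bne: "B \<noteq> {}" using B by auto
  have le: "N b \<le> n" if "b \<in> B" for b
    using that B(1) unfolding sum[symmetric] by (intro member_le_sum) auto
  then have n: "n \<ge> 1" using N(1) Bne by fastforce
  have rsum: "(\<Sum>b\<in>B. real (N b)) = n" using sum by (metis of_nat_sum)
  have "(\<Sum>b\<in>B. ln (fact (N b) :: real)) \<le>
      (\<Sum>b\<in>B. 1 + ln n / 2 - N b + N b * (ln n - ln k) + N b * (k * N b / n - 1))"
  proof (rule sum_mono)
    fix b assume b: "b \<in> B"
    have Nb: "real (N b) \<ge> 1" using N(1)[OF b] by simp
    have "ln (N b) = ln (k * N b / n) + ln n - ln k"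
      using Nb n B(3) by (simp add: ln_mult ln_div)
    also have "ln (k * N b / n) \<le> k * N b / n - 1"
      using Nb n B(3) by (intro ln_le_minus_one) auto
    finally have "N b * ln (N b) \<le> N b * (k * N b / n - 1 + ln n - ln k)"
      using Nb by (intro mult_left_mono) auto
    moreover have "ln (N b) \<le> ln n" using Nb le[OF b] n by simp
    ultimately show "ln (fact (N b) :: real) \<le> 1 + ln n / 2 - N b + N b * (ln n - ln k) + N b * (k * N b / n - 1)"
      using ln_fact_bounds(1)[OF N(1)[OF b]] by (simp add: algebra_simps)
  qed
  also have "\<dots> = k + k * ln n / 2 - n + n * (ln n - ln k) + (\<Sum>b\<in>B. N b * (k * N b / n - 1))"
    by (simp add: sum.distrib sum_subtractf B(2) rsum algebra_simps flip: sum_distrib_right sum_distrib_left)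
  \<comment> \<open>Completing the square: the linear terms left over sum to \<open>0\<close>, since
    the counts have mean \<open>n / k\<close>.\<close>
  also have "(\<Sum>b\<in>B. N b * (k * N b / n - 1)) = (\<Sum>b\<in>B. k / n * (N b - n / k)\<^sup>2 + (N b - n / k))"
    using n B(3) by (intro sum.cong) (auto simp: field_simps power2_eq_square)
  also have "\<dots> = k / n * (\<Sum>b\<in>B. (N b - n / k)\<^sup>2)"
    by (simp add: sum.distrib sum_subtractf rsum B sum_distrib_left)
  also have "\<dots> \<le> k / n * (\<Sum>b\<in>B. A\<^sup>2 * n)"
  proof (intro mult_left_mono sum_mono)
    fix b assume "b \<in> B"
    have "\<bar>N b - n / k\<bar>\<^sup>2 \<le> (A * sqrt n)\<^sup>2"
      by (rule power_mono) (use N(2)[OF \<open>b \<in> B\<close>] in auto)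
    thus "(N b - n / k)\<^sup>2 \<le> A\<^sup>2 * n" by (simp add: power_mult_distrib)
  qed auto
  also have "\<dots> = k\<^sup>2 * A\<^sup>2" using n by (simp add: B power2_eq_square)
  finally have "(\<Sum>b\<in>B. ln (fact (N b) :: real)) \<le> k + k * ln n / 2 - n + n * (ln n - ln k) + k\<^sup>2 * A\<^sup>2"
    by simp
  moreover have "ln (fact n :: real) \<ge> n * ln n - n + ln n / 2"
    by (rule ln_fact_bounds(2)[OF n])
  ultimately show ?thesis
    unfolding ln_card_count_class(2)[OF B(1) sum]
    by (simp add: algebra_simps add_divide_distrib diff_divide_distrib)
qed

text \<open>Here \<open>ln t \<le> t - 1\<close> with \<open>t = n / (k * N b)\<close> expresses
  that equal counts maximise the entropy, so the main term is \<open>n * ln k\<close> for all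
  admissible counts. The lower bound on \<open>N b\<close> controls the square-root factors in
  Stirling's formula and costs the constant with \<open>ln (2 * k)\<close>.\<close>

lemma count_class_upper:
  assumes B: "finite B" "card B = k" "k > 0" and sum: "(\<Sum>b\<in>B. N b) = n" and n: "n \<ge> 1"
    and N: "\<And>b. b \<in> B \<Longrightarrow> real (N b) \<ge> real n / (2 * real k)"
  shows "ln (card (count_class n B N)) \<le> n * ln (real k) + 1 + real k / 2 * ln (2 * real k) - (real k - 1) / 2 * ln n"
proof -
  have rsum: "(\<Sum>b\<in>B. real (N b)) = n" using sum by (metis of_nat_sum)
  have "(\<Sum>b\<in>B. N b * (ln n - ln k) - n / k + (ln n - ln (2 * real k)) / 2) \<le> (\<Sum>b\<in>B. ln (fact (N b) :: real))"
  proof (rule sum_mono)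
    fix b assume b: "b \<in> B"
    have pos: "n / (2 * real k) > 0" using n B(3) by simp
    have Nb: "real (N b) > 0" using N[OF b] pos by linarith
    have "ln (N b) = - ln (n / (k * N b)) + ln n - ln k"
      using Nb n B(3) by (simp add: ln_mult ln_div)
    moreover have "ln (n / (k * N b)) \<le> n / (k * N b) - 1"
      using Nb n B(3) by (intro ln_le_minus_one) auto
    ultimately have "N b * ln (N b) \<ge> N b * (1 - n / (k * N b) + ln n - ln k)"
      using Nb by (intro mult_left_mono) auto
    also have "N b * (1 - n / (k * N b) + ln n - ln k) = N b - n / k + N b * (ln n - ln k)"
      using Nb B(3) by (simp add: field_simps)
    finally have 1: "N b * ln (N b) \<ge> N b - n / k + N b * (ln n - ln k)" .
    have "ln (n / (2 * real k)) \<le> ln (N b)" using Nb pos N[OF b] by (subst ln_le_cancel_iff) auto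
    hence 2: "ln n - ln (2 * real k) \<le> ln (N b)" using n B(3) by (simp add: ln_div)
    have aux: "P - q + a / 2 \<le> F" if "M - q + P \<le> Z" "a \<le> L" "Z - M + L / 2 \<le> F" for P q a F M Z L :: real
      using that by linarith
    show "N b * (ln n - ln k) - n / k + (ln n - ln (2 * real k)) / 2 \<le> ln (fact (N b) :: real)"
      using aux[OF 1 2 ln_fact_bounds(2)] Nb by simp
  qed
  moreover have "(\<Sum>b\<in>B. N b * (ln n - ln k) - n / k + (ln n - ln (2 * real k)) / 2) =
      n * (ln n - ln k) - n + k * (ln n - ln (2 * real k)) / 2"
    using B(3) by (simp add: sum.distrib sum_subtractf B(2) rsum flip: sum_distrib_right)
  moreover have "ln (fact n :: real) \<le> 1 + (n * ln n - n + ln n / 2)"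
    by (rule ln_fact_bounds(1)[OF n])
  ultimately show ?thesis
    unfolding ln_card_count_class(2)[OF B(1) sum]
    by (simp add: algebra_simps add_divide_distrib diff_divide_distrib)
qed

section \<open>Chernoff bounds for counts\<close>

text \<open>For negative \<open>y = - x\<close> the claim is inverted:
  \<open>(1 - x + x\<^sup>2) * (1 + x + x\<^sup>2 / 2)\<close> is at least \<open>1\<close>, and its
  second factor is at most \<open>exp x\<close>.\<close>

lemma exp_le_quadratic:
  fixes y :: real
  assumes "\<bar>y\<bar> \<le> 1"
  shows "exp y \<le> 1 + y + y\<^sup>2"
proof (cases "y \<ge> 0")
  case True
  thus ?thesis using assms exp_bound[of y] by simp
next
  case False
  define x where "x = - y"
  have x: "x > 0" "x \<le> 1" using False assms by (auto simp: x_def)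
  have "1 \<le> (1 - x + x\<^sup>2) * (1 + x + x\<^sup>2 / 2)"
  proof -
    have "(1 - x + x\<^sup>2) * (1 + x + x\<^sup>2 / 2) = 1 + (x ^ 2 + x ^ 3 + x ^ 4) / 2"
      by (simp add: field_simps power2_eq_square power3_eq_cube power4_eq_xxxx)
    thus ?thesis using x by simp
  qed
  also have "\<dots> \<le> (1 - x + x\<^sup>2) * exp x"
    using x exp_lower_Taylor_quadratic[of x] by (intro mult_left_mono) auto
  finally have "exp (- x) \<le> 1 - x + x\<^sup>2" by (simp add: exp_minus field_simps)
  thus ?thesis by (simp add: x_def)
qed

text \<open>The exponential moment method, written as counting: the moment factorises over
  coordinates, and \<open>g\<close> having mean zero leaves at most \<open>exp (l\<^sup>2)\<close>
  per coordinate after normalisation.\<close>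

lemma PiE_sum_tail:
  fixes g :: "'b \<Rightarrow> real" and A :: real
  assumes B: "finite B" "card B = k" "k > 0" and g0: "(\<Sum>b\<in>B. g b) = 0"
    and g1: "\<And>b. b \<in> B \<Longrightarrow> \<bar>g b\<bar> \<le> 1" and A: "0 < A" "A \<le> 2 * sqrt n"
  shows "card {x \<in> {..<n} \<rightarrow>\<^sub>E B. (\<Sum>i<n. g (x i)) \<ge> A * sqrt n} \<le> exp (- A\<^sup>2 / 4) * k ^ n"
proof -
  have n: "n > 0" using A by (cases n) auto
  \<comment> \<open>This value minimises \<open>n * l\<^sup>2 - l * A * sqrt n\<close>; the
    hypothesis \<open>A \<le> 2 * sqrt n\<close> says precisely that it is at most \<open>1\<close>,
    as the quadratic bound on \<open>exp\<close> requires.\<close>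
  define l where "l = A / (2 * sqrt n)"
  have l: "l > 0" "l \<le> 1" using A n by (auto simp: l_def field_simps)
  let ?E = "{x \<in> {..<n} \<rightarrow>\<^sub>E B. (\<Sum>i<n. g (x i)) \<ge> A * sqrt n}"
  have fin: "finite ({..<n} \<rightarrow>\<^sub>E B)" using B by (intro finite_PiE) auto
  have "card ?E * exp (l * (A * sqrt n)) = (\<Sum>x\<in>?E. exp (l * (A * sqrt n)))" by simp
  also have "\<dots> \<le> (\<Sum>x\<in>?E. exp (l * (\<Sum>i<n. g (x i))))"
    using l by (intro sum_mono) auto
  also have "\<dots> \<le> (\<Sum>x\<in>{..<n} \<rightarrow>\<^sub>E B. exp (l * (\<Sum>i<n. g (x i))))"
    using fin by (intro sum_mono2) auto
  also have "\<dots> = (\<Sum>x\<in>{..<n} \<rightarrow>\<^sub>E B. \<Prod>i<n. exp (l * g (x i)))"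
    by (simp add: sum_distrib_left exp_sum)
  also have "\<dots> = (\<Prod>i<n. \<Sum>b\<in>B. exp (l * g b))"
    using B by (subst prod_sum_PiE) auto
  also have "\<dots> = (\<Sum>b\<in>B. exp (l * g b)) ^ n" by simp
  also have "\<dots> \<le> (k * exp (l\<^sup>2)) ^ n"
  proof (rule power_mono)
    have "(\<Sum>b\<in>B. exp (l * g b)) \<le> (\<Sum>b\<in>B. 1 + l * g b + l\<^sup>2)"
    proof (rule sum_mono)
      fix b assume b: "b \<in> B"
      have "\<bar>l * g b\<bar> \<le> 1" using l g1[OF b] by (simp add: abs_mult mult_le_one)
      hence "exp (l * g b) \<le> 1 + l * g b + (l * g b)\<^sup>2" by (rule exp_le_quadratic)
      also have "(l * g b)\<^sup>2 \<le> l\<^sup>2"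
        using g1[OF b] by (simp add: power_mult_distrib mult_left_le abs_square_le_1)
      finally show "exp (l * g b) \<le> 1 + l * g b + l\<^sup>2" by simp
    qed
    also have "\<dots> = k * (1 + l\<^sup>2)" using B g0 by (simp add: sum.distrib algebra_simps flip: sum_distrib_left)
    also have "\<dots> \<le> k * exp (l\<^sup>2)" by (intro mult_left_mono) auto
    finally show "(\<Sum>b\<in>B. exp (l * g b)) \<le> k * exp (l\<^sup>2)" .
  qed (auto intro!: sum_nonneg)
  also have "\<dots> = exp (n * l\<^sup>2) * k ^ n"
    by (simp add: power_mult_distrib exp_of_nat_mult)
  also have "n * l\<^sup>2 = A\<^sup>2 / 4" using n by (simp add: l_def power_divide power_mult_distrib)
  also have "l * (A * sqrt n) = A\<^sup>2 / 2" using n by (simp add: l_def power2_eq_square)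
  finally have "card ?E * exp (A\<^sup>2 / 2) \<le> exp (A\<^sup>2 / 4) * k ^ n" .
  hence "card ?E * exp (A\<^sup>2 / 2) * exp (- (A\<^sup>2 / 2)) \<le> exp (A\<^sup>2 / 4) * k ^ n * exp (- (A\<^sup>2 / 2))"
    by (rule mult_right_mono) auto
  also have "exp (A\<^sup>2 / 4) * k ^ n * exp (- (A\<^sup>2 / 2)) = exp (A\<^sup>2 / 4 + - (A\<^sup>2 / 2)) * k ^ n"
    unfolding exp_add by (simp add: algebra_simps)
  also have "A\<^sup>2 / 4 + - (A\<^sup>2 / 2) = - A\<^sup>2 / 4" by simp
  finally show ?thesis by (simp add: mult.assoc flip: exp_add)
qed

text \<open>The one-sided bound is applied to the centred indicator of \<open>a\<close> and to its
  negative, whence the factor \<open>2\<close>.\<close>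

lemma PiE_count_tail:
  fixes A :: real
  assumes B: "finite B" "card B = k" and a: "a \<in> B" and A: "0 < A" "A \<le> 2 * sqrt n"
  shows "card {x \<in> {..<n} \<rightarrow>\<^sub>E B. \<bar>card {i \<in> {..<n}. x i = a} - real n / k\<bar> > A * sqrt n}
    \<le> 2 * exp (- A\<^sup>2 / 4) * k ^ n"
proof -
  define g where "g = (\<lambda>b. of_bool (b = a) - 1 / k :: real)"
  have k: "k > 0" using B a by (auto simp: card_gt_0_iff)
  have g0: "(\<Sum>b\<in>B. g b) = 0"
    using B a k by (simp add: g_def sum_subtractf)
  have g1: "\<bar>g b\<bar> \<le> 1" for b using k by (auto simp: g_def abs_if field_simps)
  have sg: "(\<Sum>i<n. g (x i)) = card {i \<in> {..<n}. x i = a} - real n / k" for x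
    by (simp add: g_def sum_subtractf Int_def)
  let ?E = "\<lambda>g. {x \<in> {..<n} \<rightarrow>\<^sub>E B. (\<Sum>i<n. g (x i)) \<ge> A * sqrt n}"
  have fin: "finite ({..<n} \<rightarrow>\<^sub>E B)" using B by (intro finite_PiE) auto
  have "{x \<in> {..<n} \<rightarrow>\<^sub>E B. \<bar>card {i \<in> {..<n}. x i = a} - real n / k\<bar> > A * sqrt n} \<subseteq> ?E g \<union> ?E (\<lambda>b. - g b)"
  proof
    fix x assume x: "x \<in> {x \<in> {..<n} \<rightarrow>\<^sub>E B. \<bar>card {i \<in> {..<n}. x i = a} - real n / k\<bar> > A * sqrt n}"
    hence "\<bar>\<Sum>i<n. g (x i)\<bar> > A * sqrt n" unfolding sg by blast
    hence "(\<Sum>i<n. g (x i)) \<ge> A * sqrt n \<or> (\<Sum>i<n. - g (x i)) \<ge> A * sqrt n"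
      unfolding sum_negf by linarith
    thus "x \<in> ?E g \<union> ?E (\<lambda>b. - g b)" using x by blast
  qed
  hence "card {x \<in> {..<n} \<rightarrow>\<^sub>E B. \<bar>card {i \<in> {..<n}. x i = a} - real n / k\<bar> > A * sqrt n} \<le> card (?E g \<union> ?E (\<lambda>b. - g b))"
    using fin by (intro card_mono) auto
  also have "\<dots> \<le> card (?E g) + card (?E (\<lambda>b. - g b))" by (rule card_Un_le)
  finally have "real (card {x \<in> {..<n} \<rightarrow>\<^sub>E B. \<bar>card {i \<in> {..<n}. x i = a} - real n / k\<bar> > A * sqrt n}) \<le> real (card (?E g)) + real (card (?E (\<lambda>b. - g b)))"
    by linarith
  moreover have "real (card (?E g)) \<le> exp (- A\<^sup>2 / 4) * real k ^ n"
    using PiE_sum_tail[OF B k g0 g1 A] by simp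
  moreover have "real (card (?E (\<lambda>b. - g b))) \<le> exp (- A\<^sup>2 / 4) * real k ^ n"
    using PiE_sum_tail[OF B k _ _ A, of "\<lambda>b. - g b"] g0 g1 by (simp add: sum_negf)
  ultimately show ?thesis by simp
qed

section \<open>Lines in the affine plane\<close>

abbreviation residues_mod :: "nat \<Rightarrow> int set" where
  "residues_mod p \<equiv> {0..<int p}"

definition ap_coord :: "nat \<Rightarrow> nat \<Rightarrow> int \<times> int \<Rightarrow> int" where
  "ap_coord p j v = (fst v + (int j - 1) * snd v) mod int p"

lemma ap_coord_mem: "p > 0 \<Longrightarrow> ap_coord p j v \<in> residues_mod p"
  by (simp add: ap_coord_def)

lemma eq_if_dvd_diff_residues:
  assumes "a \<in> residues_mod p" "b \<in> residues_mod p" "int p dvd a - b"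
  shows "a = b"
proof -
  have "a mod int p = b mod int p" using assms(3) by (simp add: mod_eq_dvd_iff)
  thus ?thesis using assms(1,2) by simp
qed

lemma bij_betw_if_inj_on_self:
  assumes "finite X" "inj_on f X" "f ` X \<subseteq> X"
  shows "bij_betw f X X"
  using assms endo_inj_surj[of X f] by (simp add: bij_betw_def)

text \<open>Two lines of different directions meet in one point. Subtracting the two congruences
  leaves \<open>(j - j') * (d - d')\<close> divisible by \<open>p\<close>; primality and
  \<open>0 < \<bar>j - j'\<bar> < p\<close> then force \<open>d = d'\<close>.\<close>

lemma ap_coord_bij:
  assumes "prime p" "j \<in> {1..p}" "j' \<in> {1..p}" "j \<noteq> j'"
  shows "bij_betw (\<lambda>v. (ap_coord p j v, ap_coord p j' v))
    (residues_mod p \<times> residues_mod p) (residues_mod p \<times> residues_mod p)"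
proof (rule bij_betw_if_inj_on_self)
  have p: "p > 0" using assms(1) prime_gt_0_nat by blast
  have pi: "prime (int p)" using assms(1) by simp
  show "inj_on (\<lambda>v. (ap_coord p j v, ap_coord p j' v)) (residues_mod p \<times> residues_mod p)"
  proof (rule inj_onI)
    fix v v' assume v: "v \<in> residues_mod p \<times> residues_mod p" "v' \<in> residues_mod p \<times> residues_mod p"
      and eq: "(ap_coord p j v, ap_coord p j' v) = (ap_coord p j v', ap_coord p j' v')"
    obtain x d x' d' where xd: "v = (x, d)" "v' = (x', d')" by fastforce
    have 1: "int p dvd (x + (int j - 1) * d) - (x' + (int j - 1) * d')"
      using eq by (simp add: xd ap_coord_def mod_eq_dvd_iff)
    moreover have 2: "int p dvd (x + (int j' - 1) * d) - (x' + (int j' - 1) * d')"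
      using eq by (simp add: xd ap_coord_def mod_eq_dvd_iff)
    ultimately have "int p dvd ((x + (int j - 1) * d) - (x' + (int j - 1) * d'))
        - ((x + (int j' - 1) * d) - (x' + (int j' - 1) * d'))" by (rule dvd_diff)
    also have "\<dots> = (int j - int j') * (d - d')" by (simp add: algebra_simps)
    finally have "int p dvd int j - int j' \<or> int p dvd d - d'"
      using pi by (simp add: prime_dvd_mult_iff)
    moreover have "\<not> int p dvd int j - int j'"
    proof
      assume "int p dvd int j - int j'"
      hence "\<bar>int p\<bar> \<le> \<bar>int j - int j'\<bar>" using assms(4) by (intro dvd_imp_le_int) auto
      thus False using assms(2,3) by auto
    qed
    ultimately have "d = d'" using v by (intro eq_if_dvd_diff_residues[of d p d']) (auto simp: xd)
    moreover have "x = x'"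
      using 1 v by (intro eq_if_dvd_diff_residues[of x p x']) (auto simp: xd \<open>d = d'\<close>)
    ultimately show "v = v'" by (simp add: xd)
  qed
qed (use assms(1) prime_gt_0_nat ap_coord_mem in auto)

text \<open>The lines of constant difference form the remaining parallel class, which is transversal
  to all lines read off by the terms of the progression.\<close>

lemma ap_coord_snd_bij:
  assumes "p > 0"
  shows "bij_betw (\<lambda>v. (ap_coord p j v, snd v))
    (residues_mod p \<times> residues_mod p) (residues_mod p \<times> residues_mod p)"
proof (rule bij_betw_if_inj_on_self)
  show "inj_on (\<lambda>v. (ap_coord p j v, snd v)) (residues_mod p \<times> residues_mod p)"
  proof (rule inj_onI)
    fix v v' assume v: "v \<in> residues_mod p \<times> residues_mod p" "v' \<in> residues_mod p \<times> residues_mod p"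
      and eq: "(ap_coord p j v, snd v) = (ap_coord p j v', snd v')"
    have "int p dvd fst v - fst v'"
      using eq by (auto simp: ap_coord_def mod_eq_dvd_iff)
    hence "fst v = fst v'"
      using v by (intro eq_if_dvd_diff_residues[of _ p]) (auto simp: mem_Times_iff)
    thus "v = v'" using eq by (simp add: prod_eq_iff)
  qed
qed (use assms ap_coord_mem in auto)

text \<open>Along the line \<open>f = a\<close> the transversal coordinate \<open>g\<close> takes
  each value exactly once.\<close>

lemma sum_fibre_bij:
  fixes h :: "'b \<Rightarrow> 'c::comm_monoid_add"
  assumes "bij_betw (\<lambda>v. (f v, g v)) X (Y \<times> Z)" "finite X" "finite Y" "a \<in> Y"
  shows "(\<Sum>v | v \<in> X \<and> f v = a. h (g v)) = (\<Sum>b\<in>Z. h b)"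
proof -
  have "(\<Sum>v | v \<in> X \<and> f v = a. h (g v)) = (\<Sum>v\<in>X. if f v = a then h (g v) else 0)"
    using assms(2) by (simp add: sum.inter_filter)
  also have "\<dots> = (\<Sum>(y, b)\<in>Y \<times> Z. if y = a then h b else 0)"
    using sum.reindex_bij_betw[OF assms(1), of "\<lambda>(y, b). if y = a then h b else 0"]
    by (simp add: case_prod_beta)
  also have "\<dots> = (\<Sum>y\<in>Y. \<Sum>b\<in>Z. if y = a then h b else 0)"
    by (simp add: sum.cartesian_product)
  also have "\<dots> = (\<Sum>y\<in>Y. if y = a then (\<Sum>b\<in>Z. h b) else 0)"
    by (intro sum.cong) auto
  also have "\<dots> = (\<Sum>b\<in>Z. h b)" using assms(3,4) by (simp add: sum.delta')
  finally show ?thesis .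
qed

section \<open>Integer functions on the plane with prescribed line sums\<close>

text \<open>Each value is the first integer from the floor of \<open>n / m\<close> onwards with the
  right residue. As \<open>N0\<close> also sums to \<open>n\<close>, the defect \<open>D\<close> of
  the total is a multiple of \<open>p\<close>, so adding it at the single point \<open>b0\<close>
  preserves residues; its size is at most \<open>m * p\<close>.\<close>

lemma near_uniform_with_residues:
  fixes N0 :: "'b \<Rightarrow> int"
  assumes B: "finite B" "card B = m" "m > 0" and p: "p > 0" and N0: "(\<Sum>b\<in>B. N0 b) = int n"
  obtains N1 :: "'b \<Rightarrow> int" where "(\<Sum>b\<in>B. N1 b) = int n"
    "\<And>b. b \<in> B \<Longrightarrow> int p dvd N1 b - N0 b"
    "\<And>b. b \<in> B \<Longrightarrow> \<bar>real_of_int (N1 b) - real n / m\<bar> \<le> real p + real m * real p"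
proof -
  define q where "q = int (n div m)"
  define M where "M b = q + (N0 b - q) mod int p" for b
  define D where "D = int n - (\<Sum>b\<in>B. M b)"
  obtain b0 where b0: "b0 \<in> B" using B by fastforce
  define N1 where "N1 b = M b + (if b = b0 then D else 0)" for b
  have q: "q \<le> real n / m" "real n / m < q + 1"
  proof -
    have "q = \<lfloor>real n / m\<rfloor>" by (simp add: q_def floor_divide_of_nat_eq)
    thus "q \<le> real n / m" "real n / m < q + 1" by linarith+
  qed
  have M: "\<bar>real_of_int (M b) - real n / m\<bar> \<le> p" for b
  proof -
    have "0 \<le> (N0 b - q) mod int p" "(N0 b - q) mod int p \<le> int p - 1"
      using p pos_mod_bound[of "int p" "N0 b - q"] by auto
    hence "real_of_int q \<le> real_of_int (M b)" "real_of_int (M b) \<le> real_of_int (q + int p - 1)"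
      by (auto simp: M_def simp del: of_int_add of_int_diff)
    thus ?thesis using q by (simp add: abs_le_iff)
  qed
  have dvdM: "int p dvd M b - N0 b" for b
  proof -
    have "N0 b - M b = (N0 b - q) - (N0 b - q) mod int p" by (simp add: M_def)
    hence "int p dvd N0 b - M b" by (simp add: minus_mod_eq_mult_div)
    thus ?thesis by (subst dvd_diff_commute)
  qed
  have "D = (\<Sum>b\<in>B. - (M b - N0 b))" by (simp add: D_def N0 sum_subtractf sum_negf)
  hence dvdD: "int p dvd D" using dvdM by (auto intro!: dvd_sum simp: dvd_diff_commute)
  have "real_of_int D = (\<Sum>b\<in>B. real n / m - M b)" using B by (simp add: D_def sum_subtractf)
  also have "\<bar>\<dots>\<bar> \<le> (\<Sum>b\<in>B. real p)"
    by (rule sum_abs[THEN order_trans], rule sum_mono) (use M in \<open>simp add: abs_minus_commute\<close>)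
  finally have D: "\<bar>real_of_int D\<bar> \<le> m * p" using B by simp
  show thesis
  proof (rule that)
    show "(\<Sum>b\<in>B. N1 b) = int n" using B(1) b0 by (simp add: N1_def sum.distrib D_def)
    show "int p dvd N1 b - N0 b" for b
      using dvd_add[OF dvdM[of b] dvdD] dvdM[of b] by (auto simp: N1_def algebra_simps)
    show "\<bar>real_of_int (N1 b) - real n / m\<bar> \<le> real p + real m * real p" for b
    proof (cases "b = b0")
      case True
      thus ?thesis using M[of b0] D by (simp add: N1_def)
    next
      case False
      have "\<bar>real_of_int (N1 b) - real n / m\<bar> \<le> p" using False M[of b] by (simp add: N1_def)
      thus ?thesis by (rule order_trans) simp
    qed
  qed
qed

lemma card_ap_line:
  assumes "p > 0" "a \<in> residues_mod p"
  shows "card {v \<in> residues_mod p \<times> residues_mod p. ap_coord p j v = a} = p"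
proof -
  have "(\<Sum>v | v \<in> residues_mod p \<times> residues_mod p \<and> ap_coord p j v = a. 1) = (\<Sum>b\<in>residues_mod p. 1 :: nat)"
    by (rule sum_fibre_bij[OF ap_coord_snd_bij]) (use assms in auto)
  thus ?thesis by simp
qed

lemma sum_ap_lines:
  fixes h :: "int \<times> int \<Rightarrow> 'c::comm_monoid_add"
  assumes "p > 0"
  shows "(\<Sum>a\<in>residues_mod p. \<Sum>v | v \<in> residues_mod p \<times> residues_mod p \<and> ap_coord p j v = a. h v)
    = (\<Sum>v\<in>residues_mod p \<times> residues_mod p. h v)"
  by (rule sum.group) (use assms ap_coord_mem in auto)

text \<open>The left-hand side explicitly solves the line sum equations whose right-hand sides are multiples of \<open>p\<close>;
  the term \<open>k\<close> in the one direction not visited by the progression is the remaining freedom.\<close>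

lemma line_sum_of_combination:
  fixes u :: "nat \<Rightarrow> int \<Rightarrow> int" and k :: "int \<Rightarrow> int"
  assumes p: "prime p" and j: "j \<in> {1..p}" and a: "a \<in> residues_mod p"
    and u: "\<And>j. j \<in> {1..p} \<Longrightarrow> (\<Sum>a\<in>residues_mod p. u j a) = 0"
    and k: "(\<Sum>d\<in>residues_mod p. k d) = 0"
  shows "(\<Sum>v | v \<in> residues_mod p \<times> residues_mod p \<and> ap_coord p j v = a.
      (\<Sum>j'\<in>{1..p}. u j' (ap_coord p j' v)) + k (snd v)) = int p * u j a"
proof -
  have p0: "p > 0" using p prime_gt_0_nat by blast
  let ?X = "{v. v \<in> residues_mod p \<times> residues_mod p \<and> ap_coord p j v = a}"
  \<comment> \<open>On a line of direction \<open>j\<close> the function \<open>u j\<close> is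
    constant over \<open>p\<close> points, while any other \<open>u j'\<close> runs once through all
    its values and cancels.\<close>
  have lines: "(\<Sum>v\<in>?X. u j' (ap_coord p j' v)) = (if j' = j then int p * u j a else 0)" if j': "j' \<in> {1..p}" for j'
  proof (cases "j' = j")
    case True
    have "(\<Sum>v\<in>?X. u j' (ap_coord p j' v)) = (\<Sum>v\<in>?X. u j a)" using True by (intro sum.cong) auto
    thus ?thesis using True card_ap_line[OF p0 a, of j] by simp
  next
    case False
    have "(\<Sum>v\<in>?X. u j' (ap_coord p j' v)) = (\<Sum>b\<in>residues_mod p. u j' b)"
      by (rule sum_fibre_bij[OF ap_coord_bij[OF p j j']]) (use False a in auto)
    thus ?thesis using False u[OF j'] by simp
  qed
  have "(\<Sum>v\<in>?X. \<Sum>j'\<in>{1..p}. u j' (ap_coord p j' v)) = (\<Sum>j'\<in>{1..p}. \<Sum>v\<in>?X. u j' (ap_coord p j' v))"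
    by (rule sum.swap)
  also have "\<dots> = (\<Sum>j'\<in>{1..p}. if j' = j then int p * u j a else 0)"
    using lines by (rule sum.cong[OF refl])
  also have "\<dots> = int p * u j a" using j by simp
  finally have 1: "(\<Sum>v\<in>?X. \<Sum>j'\<in>{1..p}. u j' (ap_coord p j' v)) = int p * u j a" .
  have "(\<Sum>v\<in>?X. k (snd v)) = (\<Sum>d\<in>residues_mod p. k d)"
    by (rule sum_fibre_bij[OF ap_coord_snd_bij[OF p0]]) (use a in auto)
  thus ?thesis unfolding sum.distrib 1 k by simp
qed

section \<open>Progressions encoded by their coordinates\<close>

text \<open>A progression is encoded as one vector \<open>z\<close> of pairs (start, difference), so
  that counting progressions becomes an instance of \<open>count_class\<close>.\<close>

definition ap_vec :: "nat \<Rightarrow> nat \<Rightarrow> (nat \<Rightarrow> int \<times> int) \<Rightarrow> nat \<Rightarrow> nat \<Rightarrow> int" where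
  "ap_vec p n z j = (\<lambda>i\<in>{..<n}. ap_coord p j (z i))"

lemma ap_vec_mem: "p > 0 \<Longrightarrow> ap_vec p n z j \<in> Fp_vec p n"
  using ap_coord_mem by (auto simp: ap_vec_def Fp_vec_def residue_ring_def)

lemma weight_ap_vec:
  assumes "z \<in> {..<n} \<rightarrow>\<^sub>E residues_mod p \<times> residues_mod p"
  shows "weight n a (ap_vec p n z j) =
    (\<Sum>v | v \<in> residues_mod p \<times> residues_mod p \<and> ap_coord p j v = a. card {i \<in> {..<n}. z i = v})"
proof -
  have "{i \<in> {..<n}. ap_vec p n z j i = a} =
      (\<Union>v\<in>{v. v \<in> residues_mod p \<times> residues_mod p \<and> ap_coord p j v = a}. {i \<in> {..<n}. z i = v})"
    using PiE_mem[OF assms] by (auto simp: ap_vec_def)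
  hence "weight n a (ap_vec p n z j) = card \<dots>" by (simp add: weight_def)
  thus ?thesis by (subst (asm) card_UN_disjoint) auto
qed

lemma sum_card_fibres:
  assumes "finite B" "z \<in> {..<n} \<rightarrow>\<^sub>E B"
  shows "(\<Sum>b\<in>B. card {i \<in> {..<n}. z i = b}) = n"
proof -
  have "(\<Sum>b\<in>B. card {i \<in> {..<n}. z i = b}) = card (\<Union>b\<in>B. {i \<in> {..<n}. z i = b})"
    using assms(1) by (intro card_UN_disjoint[symmetric]) auto
  also have "(\<Union>b\<in>B. {i \<in> {..<n}. z i = b}) = {..<n}" using assms(2) by auto
  finally show ?thesis by simp
qed

text \<open>A near-uniform \<open>N1\<close> with the residues of the counts of \<open>z0\<close>
  has line sums congruent to the prescribed weights; the differences divided by \<open>p\<close>,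
  spread along the lines, repair them. The freedom \<open>k\<close> stays in the conclusion because
  many solutions are to be counted. Nonnegativity is not yet claimed.\<close>

lemma line_counts_exist:
  fixes w :: "nat \<Rightarrow> int \<Rightarrow> nat" and A :: real
  assumes p: "prime p" and z0: "z0 \<in> {..<n} \<rightarrow>\<^sub>E residues_mod p \<times> residues_mod p"
    and A: "A \<ge> 1" and n: "sqrt n \<ge> (real p)\<^sup>2 * (A + 4 * real p)"
    and w1: "\<And>j. j \<in> {1..p} \<Longrightarrow> (\<Sum>a\<in>residues_mod p. w j a) = n"
    and w2: "\<And>j a. j \<in> {1..p} \<Longrightarrow> a \<in> residues_mod p \<Longrightarrow>
      w j a mod p = weight n a (ap_vec p n z0 j) mod p"
    and w3: "\<And>j a. j \<in> {1..p} \<Longrightarrow> a \<in> residues_mod p \<Longrightarrow> \<bar>w j a - real n / p\<bar> \<le> A * sqrt n"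
  obtains N :: "int \<times> int \<Rightarrow> int" where
    "\<And>k j a. (\<Sum>d\<in>residues_mod p. k d) = 0 \<Longrightarrow> j \<in> {1..p} \<Longrightarrow> a \<in> residues_mod p \<Longrightarrow>
       (\<Sum>v | v \<in> residues_mod p \<times> residues_mod p \<and> ap_coord p j v = a. N v + k (snd v)) = int (w j a)"
    "\<And>v. v \<in> residues_mod p \<times> residues_mod p \<Longrightarrow>
       \<bar>real_of_int (N v) - real n / real (p\<^sup>2)\<bar> \<le> (A + real p) * sqrt n"
proof -
  let ?P = "residues_mod p \<times> residues_mod p"
  let ?L = "\<lambda>j a. {v. v \<in> ?P \<and> ap_coord p j v = a}"
  have p2: "p \<ge> 2" using p prime_ge_2_nat by blast
  hence p0: "p > 0" by simp
  have cP: "card ?P = p\<^sup>2" by (simp add: power2_eq_square)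
  define N0 where "N0 v = int (card {i \<in> {..<n}. z0 i = v})" for v
  have "(\<Sum>v\<in>?P. N0 v) = int n"
    using sum_card_fibres[OF _ z0] by (simp add: N0_def flip: of_nat_sum)
  then obtain N1 where N1: "(\<Sum>v\<in>?P. N1 v) = int n"
    "\<And>v. v \<in> ?P \<Longrightarrow> int p dvd N1 v - N0 v"
    "\<And>v. v \<in> ?P \<Longrightarrow> \<bar>N1 v - real n / real (p\<^sup>2)\<bar> \<le> p + real (p\<^sup>2) * p"
    using near_uniform_with_residues[OF _ cP _ p0, of N0 n] p0 by auto
  define w' where "w' j a = (\<Sum>v\<in>?L j a. N1 v)" for j a
  have "p + p\<^sup>2 * p \<le> 2 * p ^ 3"
    using p0 by (cases p) (auto simp: power2_eq_square power3_eq_cube)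
  hence "real (p + p\<^sup>2 * p) \<le> real (2 * p ^ 3)" by (subst of_nat_le_iff)
  hence pp: "p + real (p\<^sup>2) * p \<le> 2 * real p ^ 3" by simp
  have bN1: "\<bar>N1 v - real n / real (p\<^sup>2)\<bar> \<le> 2 * real p ^ 3" if "v \<in> ?P" for v
    using N1(3)[OF that] pp by linarith
  have bw': "\<bar>w' j a - real n / p\<bar> \<le> 2 * real p ^ 4" if a: "a \<in> residues_mod p" for j a
  proof -
    have "real_of_int (w' j a) - real n / p = (\<Sum>v\<in>?L j a. N1 v - real n / real (p\<^sup>2))"
      using card_ap_line[OF p0 a, of j] p0 by (simp add: w'_def sum_subtractf power2_eq_square)
    also have "\<bar>\<dots>\<bar> \<le> (\<Sum>v\<in>?L j a. 2 * real p ^ 3)"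
      by (rule sum_abs[THEN order_trans], rule sum_mono) (use bN1 in auto)
    also have "\<dots> = 2 * real p ^ 4"
      using card_ap_line[OF p0 a, of j] by (simp add: power3_eq_cube power4_eq_xxxx)
    finally show ?thesis .
  qed
  \<comment> \<open>Both numbers are congruent to the line sum of the counts of \<open>z0\<close>:
    the first by \<open>w2\<close>, the second because \<open>N1\<close> agrees with these counts
    modulo \<open>p\<close> at each point.\<close>
  have dvdw: "int p dvd int (w j a) - w' j a" if ja: "j \<in> {1..p}" "a \<in> residues_mod p" for j a
  proof -
    have "int (w j a) mod p = int (weight n a (ap_vec p n z0 j)) mod p"
      using arg_cong[OF w2[OF ja], of int] by (simp add: of_nat_mod)
    hence "int p dvd int (w j a) - (\<Sum>v\<in>?L j a. N0 v)"
      by (simp add: mod_eq_dvd_iff weight_ap_vec[OF z0] N0_def)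
    moreover have "int p dvd (\<Sum>v\<in>?L j a. N1 v - N0 v)" by (intro dvd_sum) (use N1(2) in auto)
    ultimately have "int p dvd (int (w j a) - (\<Sum>v\<in>?L j a. N0 v)) - (\<Sum>v\<in>?L j a. N1 v - N0 v)"
      by (rule dvd_diff)
    thus ?thesis by (simp add: w'_def sum_subtractf)
  qed
  define u where "u j a = (int (w j a) - w' j a) div int p" for j a
  have pu: "int p * u j a = int (w j a) - w' j a" if "j \<in> {1..p}" "a \<in> residues_mod p" for j a
    using dvdw[OF that] by (simp add: u_def)
  have su: "(\<Sum>a\<in>residues_mod p. u j a) = 0" if j: "j \<in> {1..p}" for j
  proof -
    have "int p * (\<Sum>a\<in>residues_mod p. u j a) = (\<Sum>a\<in>residues_mod p. int (w j a) - w' j a)"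
      using pu[OF j] by (simp add: sum_distrib_left)
    also have "\<dots> = int n - (\<Sum>a\<in>residues_mod p. w' j a)"
      using w1[OF j] by (simp add: sum_subtractf flip: of_nat_sum)
    also have "(\<Sum>a\<in>residues_mod p. w' j a) = int n"
      unfolding w'_def N1(1)[symmetric] by (rule sum_ap_lines[OF p0])
    finally show ?thesis using p0 by simp
  qed
  have bu: "\<bar>real_of_int (u j a)\<bar> \<le> (A * sqrt n + 2 * real p ^ 4) / p" if ja: "j \<in> {1..p}" "a \<in> residues_mod p" for j a
  proof -
    have "real p * u j a = w j a - real_of_int (w' j a)"
      using arg_cong[OF pu[OF ja], of real_of_int] by simp
    hence "\<bar>real p * u j a\<bar> = \<bar>w j a - real_of_int (w' j a)\<bar>" by (rule arg_cong)
    hence "real p * \<bar>real_of_int (u j a)\<bar> = \<bar>w j a - real_of_int (w' j a)\<bar>"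
      unfolding abs_mult by simp
    also have "\<dots> \<le> A * sqrt n + 2 * real p ^ 4"
      using w3[OF ja] bw'[OF ja(2), of j] by linarith
    finally show ?thesis using p0 by (simp add: field_simps)
  qed
  define N where "N v = N1 v + (\<Sum>j\<in>{1..p}. u j (ap_coord p j v))" for v
  show thesis
  proof (rule that)
    fix k :: "int \<Rightarrow> int" and j a
    assume k: "(\<Sum>d\<in>residues_mod p. k d) = 0" and ja: "j \<in> {1..p}" "a \<in> residues_mod p"
    have "(\<Sum>v\<in>?L j a. N v + k (snd v)) =
        (\<Sum>v\<in>?L j a. N1 v) + (\<Sum>v\<in>?L j a. (\<Sum>j'\<in>{1..p}. u j' (ap_coord p j' v)) + k (snd v))"
      unfolding N_def by (simp add: sum.distrib)
    also have "(\<Sum>v\<in>?L j a. (\<Sum>j'\<in>{1..p}. u j' (ap_coord p j' v)) + k (snd v)) = int p * u j a"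
      by (rule line_sum_of_combination[OF p ja su k])
    finally show "(\<Sum>v\<in>?L j a. N v + k (snd v)) = int (w j a)"
      by (simp add: pu[OF ja] w'_def)
  next
    fix v assume v: "v \<in> ?P"
    have "\<bar>real_of_int (\<Sum>j\<in>{1..p}. u j (ap_coord p j v))\<bar> \<le> (\<Sum>j\<in>{1..p}. \<bar>real_of_int (u j (ap_coord p j v))\<bar>)"
      by (simp add: sum_abs)
    also have "\<dots> \<le> (\<Sum>j\<in>{1..p}. (A * sqrt n + 2 * real p ^ 4) / p)"
      by (rule sum_mono) (use bu ap_coord_mem[OF p0] in blast)
    also have "\<dots> = A * sqrt n + 2 * real p ^ 4" using p0 by simp
    finally have 1: "\<bar>real_of_int (\<Sum>j\<in>{1..p}. u j (ap_coord p j v))\<bar> \<le> A * sqrt n + 2 * real p ^ 4" .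
    \<comment> \<open>The rounding errors of \<open>N1\<close> and of its line sums are absorbed
      into \<open>p * sqrt n\<close>; the summand \<open>4 * real p\<close> in the hypothesis on
      \<open>n\<close> pays for this.\<close>
    have 2: "2 * real p ^ 3 + 2 * real p ^ 4 \<le> p * sqrt n"
    proof -
      have "real p ^ 3 \<le> real p ^ 4" using p0 by (intro power_increasing) auto
      hence "2 * real p ^ 3 + 2 * real p ^ 4 \<le> 4 * real p ^ 4" by simp
      also have "\<dots> = real p * ((real p)\<^sup>2 * (4 * real p))"
        by (simp add: power2_eq_square power4_eq_xxxx)
      also have "\<dots> \<le> real p * ((real p)\<^sup>2 * (A + 4 * real p))"
        using A by (intro mult_left_mono) auto
      also have "\<dots> \<le> p * sqrt n" using n by (intro mult_left_mono) auto
      finally show ?thesis .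
    qed
    have "real_of_int (N v) = real_of_int (N1 v) + real_of_int (\<Sum>j\<in>{1..p}. u j (ap_coord p j v))"
      by (simp add: N_def)
    thus "\<bar>real_of_int (N v) - real n / real (p\<^sup>2)\<bar> \<le> (A + real p) * sqrt n"
      using 1 2 bN1[OF v] by (simp add: distrib_right)
  qed
qed

text \<open>Every choice of the free parameters gives positive counts with the prescribed line sums,
  hence a whole \<open>count_class\<close> of suitable progressions, bounded below with
  \<open>p\<^sup>2\<close> cells. Different choices give disjoint classes, so their sizes add
  up.\<close>

lemma ap_weight_class_lower:
  fixes w :: "nat \<Rightarrow> int \<Rightarrow> nat" and A :: real
  assumes p: "prime p" and z0: "z0 \<in> {..<n} \<rightarrow>\<^sub>E residues_mod p \<times> residues_mod p"
    and A: "A \<ge> 1" and n: "sqrt n \<ge> (real p)\<^sup>2 * (A + 4 * real p)"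
    and w1: "\<And>j. j \<in> {1..p} \<Longrightarrow> (\<Sum>a\<in>residues_mod p. w j a) = n"
    and w2: "\<And>j a. j \<in> {1..p} \<Longrightarrow> a \<in> residues_mod p \<Longrightarrow>
      w j a mod p = weight n a (ap_vec p n z0 j) mod p"
    and w3: "\<And>j a. j \<in> {1..p} \<Longrightarrow> a \<in> residues_mod p \<Longrightarrow> \<bar>w j a - real n / p\<bar> \<le> A * sqrt n"
  shows "real (card {z \<in> {..<n} \<rightarrow>\<^sub>E residues_mod p \<times> residues_mod p.
      \<forall>j\<in>{1..p}. \<forall>a\<in>residues_mod p. weight n a (ap_vec p n z j) = w j a}) \<ge>
    sqrt n ^ (p - 1) * exp (n * ln (real (p\<^sup>2)) - real (p\<^sup>2) - (real (p\<^sup>2))\<^sup>2 * (A + 2 * real p)\<^sup>2 - (real (p\<^sup>2) - 1) / 2 * ln n)"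
    (is "_ \<ge> _ * exp ?L")
proof -
  let ?P = "residues_mod p \<times> residues_mod p"
  let ?T = "{z \<in> {..<n} \<rightarrow>\<^sub>E ?P. \<forall>j\<in>{1..p}. \<forall>a\<in>residues_mod p. weight n a (ap_vec p n z j) = w j a}"
  have p2: "p \<ge> 2" using p prime_ge_2_nat by blast
  hence p0: "p > 0" by simp
  have cP: "card ?P = p\<^sup>2" by (simp add: power2_eq_square)
  obtain N where
    N1: "\<And>k j a. (\<Sum>d\<in>residues_mod p. k d) = 0 \<Longrightarrow> j \<in> {1..p} \<Longrightarrow> a \<in> residues_mod p \<Longrightarrow>
       (\<Sum>v | v \<in> ?P \<and> ap_coord p j v = a. N v + k (snd v)) = int (w j a)" and
    N2: "\<And>v. v \<in> ?P \<Longrightarrow> \<bar>real_of_int (N v) - real n / real (p\<^sup>2)\<bar> \<le> (A + real p) * sqrt n"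
    using line_counts_exist[OF p z0 A n w1 w2 w3] by blast
  define s where "s = \<lfloor>sqrt n\<rfloor>"
  have s: "s \<ge> 0" "real_of_int s \<le> sqrt n" "sqrt n \<le> real (nat (s + 1))" by (auto simp: s_def)
  \<comment> \<open>The \<open>p - 1\<close> free parameters \<open>\<kappa>\<close> of size \<open>\<surd>n\<close> supply the factor \<open>\<surd>n ^ (p - 1)\<close> that turns the
    bound for one \<open>N\<close> into the local probability \<open>n powr (- p (p - 1) / 2)\<close>.\<close>
  define K where "K = {1..<int p} \<rightarrow>\<^sub>E {0..s}"
  \<comment> \<open>The value at \<open>0\<close> balances the others, so that
    \<open>k \<kappa>\<close> sums to zero as the line sum identity demands.\<close>
  define k where "k \<kappa> d = (if d = 0 then - (\<Sum>e\<in>{1..<int p}. \<kappa> e) else \<kappa> d)" for \<kappa> :: "int \<Rightarrow> int" and d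
  define M where "M \<kappa> v = nat (N v + k \<kappa> (snd v))" for \<kappa> v
  have finK: "finite K" by (auto simp: K_def intro!: finite_PiE)
  have cK: "real (card K) \<ge> sqrt n ^ (p - 1)"
  proof -
    have "card K = nat (s + 1) ^ (p - 1)" by (simp add: K_def card_PiE nat_diff_distrib')
    thus ?thesis using s by (simp add: power_mono del: of_nat_nat)
  qed
  have rp: "residues_mod p = insert 0 {1..<int p}" using p0 by auto
  have k0: "(\<Sum>d\<in>residues_mod p. k \<kappa> d) = 0" for \<kappa>
    unfolding rp by (simp add: k_def)
  have kb: "\<bar>real_of_int (k \<kappa> d)\<bar> \<le> p * sqrt n" if \<kappa>: "\<kappa> \<in> K" and d: "d \<in> residues_mod p" for \<kappa> d
  proof -
    have \<kappa>b: "0 \<le> \<kappa> e \<and> \<kappa> e \<le> s" if "e \<in> {1..<int p}" for e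
      using PiE_mem[OF \<kappa>[unfolded K_def] that] by simp
    have "\<bar>k \<kappa> d\<bar> \<le> int p * s"
    proof (cases "d = 0")
      case True
      have "(\<Sum>e\<in>{1..<int p}. \<kappa> e) \<le> (\<Sum>e\<in>{1..<int p}. s)" using \<kappa>b by (intro sum_mono) auto
      also have "\<dots> = (int p - 1) * s" using p0 by simp
      also have "\<dots> \<le> int p * s" using s by (intro mult_right_mono) auto
      moreover have "(\<Sum>e\<in>{1..<int p}. \<kappa> e) \<ge> 0" using \<kappa>b by (intro sum_nonneg) auto
      ultimately show ?thesis using True by (simp add: k_def)
    next
      case False
      hence "d \<in> {1..<int p}" using d by auto
      hence "\<bar>k \<kappa> d\<bar> \<le> 1 * s" using \<kappa>b[of d] False by (simp add: k_def)
      also have "\<dots> \<le> int p * s" using s p0 by (intro mult_right_mono) auto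
      finally show ?thesis .
    qed
    hence "\<bar>real_of_int (k \<kappa> d)\<bar> \<le> real_of_int (int p * s)" by linarith
    also have "\<dots> = p * real_of_int s" by simp
    also have "\<dots> \<le> p * sqrt n" using s by (intro mult_left_mono) auto
    finally show ?thesis .
  qed
  \<comment> \<open>The mean \<open>n / p\<^sup>2\<close> is at least
    \<open>(A + 4 * p) * sqrt n\<close>, whereas the deviation is at most
    \<open>(A + 2 * p) * sqrt n\<close>. The counts are therefore positive, and \<open>nat\<close>
    in \<open>M\<close> truncates nothing.\<close>
  have Mb: "M \<kappa> v \<ge> 1 \<and> int (M \<kappa> v) = N v + k \<kappa> (snd v) \<and>
      \<bar>M \<kappa> v - real n / real (p\<^sup>2)\<bar> \<le> (A + 2 * real p) * sqrt n" if "\<kappa> \<in> K" "v \<in> ?P" for \<kappa> v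
  proof -
    have "\<bar>real_of_int (k \<kappa> (snd v))\<bar> \<le> p * sqrt n" using that by (intro kb) auto
    hence 1: "\<bar>real_of_int (N v + k \<kappa> (snd v)) - real n / real (p\<^sup>2)\<bar> \<le> (A + 2 * real p) * sqrt n"
      using N2[OF that(2)] by (simp add: algebra_simps)
    have "real n / real (p\<^sup>2) = sqrt n * sqrt n / real (p\<^sup>2)" by simp
    also have "\<dots> \<ge> (real p)\<^sup>2 * (A + 4 * real p) * sqrt n / real (p\<^sup>2)"
      using n by (intro divide_right_mono mult_right_mono) auto
    also have "(real p)\<^sup>2 * (A + 4 * real p) * sqrt n / real (p\<^sup>2) = (A + 4 * p) * sqrt n" using p0 by simp
    finally have 2: "(A + 4 * p) * sqrt n \<le> real n / real (p\<^sup>2)" .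
    have "1 * 1 \<le> (real p)\<^sup>2 * (A + 4 * real p)" using p0 A by (intro mult_mono) auto
    also have "\<dots> \<le> sqrt n" using n by simp
    finally have "1 \<le> sqrt n" by simp
    hence "1 * 1 \<le> (2 * real p) * sqrt n" using p0 by (intro mult_mono) auto
    hence "real_of_int (N v + k \<kappa> (snd v)) \<ge> 1" using 1 2 by (simp add: algebra_simps abs_le_iff)
    hence "N v + k \<kappa> (snd v) \<ge> 1" by linarith
    thus ?thesis using 1 by (simp add: M_def)
  qed
  have Msum: "(\<Sum>v\<in>?P. M \<kappa> v) = n" if \<kappa>: "\<kappa> \<in> K" for \<kappa>
  proof -
    have one: "1 \<in> {1..p}" using p0 by simp
    have "int (\<Sum>v\<in>?P. M \<kappa> v) = (\<Sum>v\<in>?P. N v + k \<kappa> (snd v))"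
      unfolding of_nat_sum by (intro sum.cong refl) (use Mb[OF \<kappa>] in blast)
    also have "\<dots> = (\<Sum>a\<in>residues_mod p. \<Sum>v | v \<in> ?P \<and> ap_coord p 1 v = a. N v + k \<kappa> (snd v))"
      by (rule sum_ap_lines[OF p0, symmetric])
    also have "\<dots> = (\<Sum>a\<in>residues_mod p. int (w 1 a))"
      by (intro sum.cong refl N1[OF k0 one])
    also have "\<dots> = int n" using w1[OF one] by (simp flip: of_nat_sum)
    finally show ?thesis by (simp only: of_nat_eq_iff)
  qed
  have sub: "count_class n ?P (M \<kappa>) \<subseteq> ?T" if \<kappa>: "\<kappa> \<in> K" for \<kappa>
  proof
    fix z assume z: "z \<in> count_class n ?P (M \<kappa>)"
    have zP: "z \<in> {..<n} \<rightarrow>\<^sub>E ?P" using z by (simp add: count_class_def)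
    have "weight n a (ap_vec p n z j) = w j a" if ja: "j \<in> {1..p}" "a \<in> residues_mod p" for j a
    proof -
      have "int (weight n a (ap_vec p n z j)) = (\<Sum>v | v \<in> ?P \<and> ap_coord p j v = a. int (M \<kappa> v))"
        unfolding weight_ap_vec[OF zP] of_nat_sum
        by (intro sum.cong refl) (use z in \<open>auto simp: count_class_def\<close>)
      also have "\<dots> = (\<Sum>v | v \<in> ?P \<and> ap_coord p j v = a. N v + k \<kappa> (snd v))"
        by (intro sum.cong refl) (use Mb[OF \<kappa>] in blast)
      also have "\<dots> = int (w j a)" by (rule N1[OF k0 ja])
      finally show ?thesis by simp
    qed
    thus "z \<in> ?T" using zP by blast
  qed
  \<comment> \<open>The count at the point \<open>(0, d)\<close> is
    \<open>N (0, d) + \<kappa> d\<close> for nonzero \<open>d\<close>, so the counts determine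
    \<open>\<kappa>\<close>.\<close>
  have disj: "count_class n ?P (M \<kappa>) \<inter> count_class n ?P (M \<kappa>') = {}"
    if \<kappa>: "\<kappa> \<in> K" "\<kappa>' \<in> K" "\<kappa> \<noteq> \<kappa>'" for \<kappa> \<kappa>'
  proof (rule ccontr)
    assume "\<not> ?thesis"
    then obtain z where "z \<in> count_class n ?P (M \<kappa>)" "z \<in> count_class n ?P (M \<kappa>')" by blast
    hence eq: "M \<kappa> v = M \<kappa>' v" if "v \<in> ?P" for v using that by (auto simp: count_class_def)
    have "\<kappa> d = \<kappa>' d" if d: "d \<in> {1..<int p}" for d
    proof -
      have v: "(0, d) \<in> ?P" using d p0 by auto
      have "k \<kappa> d = k \<kappa>' d" using Mb[OF \<kappa>(1) v] Mb[OF \<kappa>(2) v] eq[OF v] by simp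
      thus ?thesis using d by (simp add: k_def)
    qed
    hence "\<kappa> = \<kappa>'" using \<kappa>(1,2) unfolding K_def by (intro PiE_ext[of \<kappa> _ _ \<kappa>']) auto
    thus False using \<kappa>(3) by simp
  qed
  have low: "exp ?L \<le> card (count_class n ?P (M \<kappa>))" if \<kappa>: "\<kappa> \<in> K" for \<kappa>
  proof -
    have "?L \<le> ln (card (count_class n ?P (M \<kappa>)))"
      by (rule count_class_lower[OF _ cP _ Msum[OF \<kappa>]]) (use p0 Mb[OF \<kappa>] in auto)
    moreover have "card (count_class n ?P (M \<kappa>)) > 0"
      by (rule ln_card_count_class(1)[OF _ Msum[OF \<kappa>]]) simp
    ultimately show ?thesis by (simp add: ln_ge_iff)
  qed
  have finT: "finite ?T" by (rule finite_subset[OF _ finite_PiE[of "{..<n}" "\<lambda>_. ?P"]]) auto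
  have "sqrt n ^ (p - 1) * exp ?L \<le> card K * exp ?L" by (rule mult_right_mono[OF cK]) simp
  also have "\<dots> = (\<Sum>\<kappa>\<in>K. exp ?L)" by simp
  also have "\<dots> \<le> (\<Sum>\<kappa>\<in>K. real (card (count_class n ?P (M \<kappa>))))" by (rule sum_mono[OF low])
  also have "\<dots> = card (\<Union>\<kappa>\<in>K. count_class n ?P (M \<kappa>))"
    by (subst card_UN_disjoint[OF finK]) (use disj in \<open>auto intro: finite_count_class\<close>)
  also have "\<dots> \<le> card ?T" by (intro of_nat_mono card_mono finT UN_least sub)
  finally show ?thesis .
qed

section \<open>Progressions in symmetric sets\<close>

lemma carrier_residue_ring_int: "carrier (residue_ring (int p)) = residues_mod p"
  by (auto simp: residue_ring_def)

lemma Fp_vec_eq_PiE: "Fp_vec p n = {..<n} \<rightarrow>\<^sub>E residues_mod p"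
  by (simp add: Fp_vec_def carrier_residue_ring_int)

lemma sum_weight:
  assumes "x \<in> Fp_vec p n"
  shows "(\<Sum>a\<in>residues_mod p. weight n a x) = n"
  using assms sum_card_fibres[of "residues_mod p" x n] by (simp add: weight_def Fp_vec_eq_PiE)

text \<open>Symmetric sets are unions of fibres of this map; \<open>restrict\<close> turns agreement
  of all weights into equality of functions.\<close>

definition profile :: "nat \<Rightarrow> nat \<Rightarrow> (nat \<Rightarrow> int) \<Rightarrow> int \<Rightarrow> nat" where
  "profile p n x = (\<lambda>a\<in>residues_mod p. weight n a x)"

lemma symmetric_setD_profile:
  assumes "symmetric_set p n S" "x \<in> S" "y \<in> Fp_vec p n" "profile p n x = profile p n y"
  shows "y \<in> S"
proof -
  have "weight n a x = weight n a y" if "a \<in> residues_mod p" for a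
    using fun_cong[OF assms(4), of a] that by (simp add: profile_def)
  thus ?thesis using assms(1-3) unfolding symmetric_set_def carrier_residue_ring_int by blast
qed

text \<open>Every fibre over a typical profile has at most \<open>exp ?U\<close> vectors, since the
  hypothesis on \<open>n\<close> keeps all weights above \<open>n / (2 * p)\<close>. This converts a
  density of vectors into a number of profiles.\<close>

lemma card_typical_le_profiles:
  fixes A :: real
  assumes p: "p > 0" and n: "n \<ge> 1" "sqrt n \<ge> 2 * real p * A"
    and G: "G \<subseteq> Fp_vec p n"
    and typical: "\<And>x a. x \<in> G \<Longrightarrow> a \<in> residues_mod p \<Longrightarrow> \<bar>weight n a x - real n / p\<bar> \<le> A * sqrt n"
  shows "card G \<le> card (profile p n ` G) *
    exp (n * ln (real p) + 1 + real p / 2 * ln (2 * real p) - (real p - 1) / 2 * ln n)" (is "_ \<le> _ * exp ?U")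
proof -
  have finG: "finite G" using G finite_Fp_vec finite_subset by blast
  have "card G = (\<Sum>w\<in>profile p n ` G. card {x \<in> G. profile p n x = w})"
    using sum.group[of G "profile p n ` G" "profile p n" "\<lambda>_. 1 :: nat"] finG by simp
  hence "real (card G) = (\<Sum>w\<in>profile p n ` G. real (card {x \<in> G. profile p n x = w}))" by simp
  also have "\<dots> \<le> (\<Sum>w\<in>profile p n ` G. exp ?U)"
  proof (rule sum_mono)
    fix w assume "w \<in> profile p n ` G"
    then obtain x where x: "x \<in> G" "w = profile p n x" by blast
    have w: "w a = weight n a x" if "a \<in> residues_mod p" for a using that x(2) by (simp add: profile_def)
    have sw: "(\<Sum>a\<in>residues_mod p. w a) = n"
      using sum_weight[of x p n] x(1) G w by auto
    have "w a \<ge> real n / (2 * real p)" if a: "a \<in> residues_mod p" for a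
    proof -
      have "A * sqrt n * (2 * p) \<le> sqrt n * sqrt n"
        using mult_right_mono[OF n(2), of "sqrt n"] by (simp add: algebra_simps)
      hence "A * sqrt n \<le> real n / (2 * real p)" using p by (simp add: field_simps)
      moreover have "real n / p = real n / (2 * real p) + real n / (2 * real p)" using p by (simp add: field_simps)
      ultimately show ?thesis using typical[OF x(1) a] unfolding w[OF a] by linarith
    qed
    hence "ln (card (count_class n (residues_mod p) w)) \<le>
        n * ln (real p) + 1 + real p / 2 * ln (2 * real p) - (real p - 1) / 2 * ln n"
      by (intro count_class_upper[OF _ _ _ sw n(1)]) (use p in auto)
    moreover have "card (count_class n (residues_mod p) w) > 0"
      by (rule ln_card_count_class(1)[OF _ sw]) simp
    ultimately have "card (count_class n (residues_mod p) w) \<le> exp ?U"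
      by (subst (asm) exp_le_cancel_iff[symmetric]) simp
    moreover have "card {x \<in> G. profile p n x = w} \<le> card (count_class n (residues_mod p) w)"
    proof (rule card_mono)
      show "finite (count_class n (residues_mod p) w)"
        by (rule finite_count_class) simp
      show "{x \<in> G. profile p n x = w} \<subseteq> count_class n (residues_mod p) w"
        using G by (auto simp: count_class_def Fp_vec_eq_PiE profile_def weight_def)
    qed
    ultimately show "real (card {x \<in> G. profile p n x = w}) \<le> exp ?U" by linarith
  qed
  also have "\<dots> = card (profile p n ` G) * exp ?U" by simp
  finally show ?thesis .
qed

text \<open>Every tuple of profiles, one from each \<open>G j\<close>, is realised by many
  progressions, because all its residues agree with those of \<open>z0\<close>. Tuples give disjoint
  sets of progressions, and symmetry places these progressions in the \<open>G j\<close>;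
  multiplying by the number of tuples gives the bound.\<close>

lemma ap_count_typical_lower:
  fixes A \<delta> :: real
  assumes p: "prime p" and z0: "z0 \<in> {..<n} \<rightarrow>\<^sub>E residues_mod p \<times> residues_mod p"
    and A: "A \<ge> 1" and n: "sqrt n \<ge> (real p)\<^sup>2 * (A + 4 * real p)" and \<delta>: "\<delta> \<ge> 0"
    and sym: "\<And>j. j \<in> {1..p} \<Longrightarrow> symmetric_set p n (G j)"
    and res: "\<And>j x a. j \<in> {1..p} \<Longrightarrow> x \<in> G j \<Longrightarrow> a \<in> residues_mod p \<Longrightarrow>
      weight n a x mod p = weight n a (ap_vec p n z0 j) mod p"
    and typical: "\<And>j x a. j \<in> {1..p} \<Longrightarrow> x \<in> G j \<Longrightarrow> a \<in> residues_mod p \<Longrightarrow>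
      \<bar>weight n a x - real n / p\<bar> \<le> A * sqrt n"
    and card: "\<And>j. j \<in> {1..p} \<Longrightarrow> \<delta> * real p ^ n \<le> card (G j)"
  shows "\<delta> ^ p * exp (- (real p + real p ^ 2 + real p ^ 2 / 2 * ln (2 * real p) + real p ^ 4 * (A + 2 * real p)\<^sup>2))
      * real p ^ (2 * n)
    \<le> card {z \<in> {..<n} \<rightarrow>\<^sub>E residues_mod p \<times> residues_mod p. \<forall>j\<in>{1..p}. ap_vec p n z j \<in> G j}"
    (is "_ * exp (- ?E) * _ \<le> _")
proof -
  let ?Z = "{..<n} \<rightarrow>\<^sub>E residues_mod p \<times> residues_mod p"
  define T where "T w = {z \<in> ?Z. \<forall>j\<in>{1..p}. \<forall>a\<in>residues_mod p. weight n a (ap_vec p n z j) = w j a}"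
    for w :: "nat \<Rightarrow> int \<Rightarrow> nat"
  define W where "W j = profile p n ` G j" for j
  define U where "U = n * ln (real p) + 1 + real p / 2 * ln (2 * real p) - (real p - 1) / 2 * ln n"
  define L where "L = n * ln (real (p\<^sup>2)) - real (p\<^sup>2) - (real (p\<^sup>2))\<^sup>2 * (A + 2 * real p)\<^sup>2 - (real (p\<^sup>2) - 1) / 2 * ln n"
  have p2: "p \<ge> 2" using p prime_ge_2_nat by blast
  hence p0: "p > 0" by simp
  have nA: "sqrt n \<ge> 2 * real p * A"
  proof -
    have "2 * real p * A \<le> real p * real p * A"
      using p2 A by (intro mult_right_mono) auto
    also have "\<dots> \<le> (real p)\<^sup>2 * (A + 4 * real p)"
      unfolding power2_eq_square by (intro mult_left_mono) auto
    also have "\<dots> \<le> sqrt n" using n by simp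
    finally show ?thesis .
  qed
  moreover have "0 < 2 * real p * A" using p0 A by simp
  ultimately have "sqrt n > 0" by linarith
  hence n1: "n \<ge> 1" by simp
  have G: "G j \<subseteq> Fp_vec p n" if "j \<in> {1..p}" for j
    using sym[OF that] by (simp add: symmetric_set_def)
  have finW: "finite (W j)" if "j \<in> {1..p}" for j
    using G[OF that] finite_Fp_vec finite_subset unfolding W_def by blast
  have cW: "\<delta> * real p ^ n * exp (- U) \<le> card (W j)" if j: "j \<in> {1..p}" for j
  proof -
    have "\<delta> * real p ^ n \<le> card (W j) * exp U"
      using card[OF j] card_typical_le_profiles[OF p0 n1 nA G[OF j] typical[OF j]]
      unfolding W_def U_def by linarith
    thus ?thesis by (simp add: exp_minus field_simps)
  qed
  have low: "sqrt n ^ (p - 1) * exp L \<le> card (T w)" if w: "w \<in> PiE {1..p} W" for w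
    unfolding T_def L_def
  proof (rule ap_weight_class_lower[OF p z0 A n])
    fix j assume j: "j \<in> {1..p}"
    then obtain x where x: "x \<in> G j" "w j = profile p n x"
      using PiE_mem[OF w j] by (auto simp: W_def)
    have wj: "w j a = weight n a x" if "a \<in> residues_mod p" for a
      using that x(2) by (simp add: profile_def)
    show "(\<Sum>a\<in>residues_mod p. w j a) = n"
      using sum_weight[of x p n] G[OF j] x(1) wj by auto
    fix a assume a: "a \<in> residues_mod p"
    show "w j a mod p = weight n a (ap_vec p n z0 j) mod p"
      using res[OF j x(1) a] wj[OF a] by simp
    show "\<bar>w j a - real n / p\<bar> \<le> A * sqrt n"
      using typical[OF j x(1) a] wj[OF a] by simp
  qed
  have disj: "T w \<inter> T w' = {}" if w: "w \<in> PiE {1..p} W" "w' \<in> PiE {1..p} W" "w \<noteq> w'" for w w'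
  proof (rule ccontr)
    assume "\<not> ?thesis"
    then obtain z where z: "z \<in> T w" "z \<in> T w'" by blast
    have "w j = w' j" if j: "j \<in> {1..p}" for j
    proof -
      obtain x x' where x: "w j = profile p n x" "w' j = profile p n x'"
        using PiE_mem[OF w(1) j] PiE_mem[OF w(2) j] by (auto simp: W_def)
      have "w j a = w' j a" if "a \<in> residues_mod p" for a
        using z j that unfolding T_def by fastforce
      thus ?thesis unfolding x by (auto simp: profile_def fun_eq_iff)
    qed
    hence "w = w'" using w(1,2) by (intro PiE_ext[of w _ _ w'])
    thus False using w(3) by simp
  qed
  have sub: "T w \<subseteq> {z \<in> ?Z. \<forall>j\<in>{1..p}. ap_vec p n z j \<in> G j}" if w: "w \<in> PiE {1..p} W" for w
  proof
    fix z assume z: "z \<in> T w"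
    have "ap_vec p n z j \<in> G j" if j: "j \<in> {1..p}" for j
    proof -
      obtain x where x: "x \<in> G j" "w j = profile p n x"
        using PiE_mem[OF w j] by (auto simp: W_def)
      have "profile p n x = profile p n (ap_vec p n z j)"
        using z j unfolding x(2)[symmetric] by (auto simp: T_def profile_def x(2))
      thus ?thesis using symmetric_setD_profile[OF sym[OF j] x(1) ap_vec_mem[OF p0]] by simp
    qed
    thus "z \<in> {z \<in> ?Z. \<forall>j\<in>{1..p}. ap_vec p n z j \<in> G j}" using z by (auto simp: T_def)
  qed
  have finZ: "finite ?Z" by (rule finite_PiE) auto
  have finP: "finite (PiE {1..p} W)" using finW by (intro finite_PiE) auto
  have finT: "finite (T w)" for w using finZ by (simp add: T_def)
  have "\<delta> ^ p * exp (- ?E) * real p ^ (2 * n) = (\<delta> * real p ^ n * exp (- U)) ^ p * (sqrt n ^ (p - 1) * exp L)"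
  proof -
    have e1: "real p ^ n = exp (n * ln p)" using p0 by (simp add: exp_of_nat_mult)
    have e2: "real p ^ (2 * n) = exp (2 * n * ln p)" using p0 exp_of_nat_mult[of "2 * n" "ln (real p)"] by simp
    have e3: "sqrt n ^ (p - 1) = exp ((real p - 1) * (ln n / 2))"
    proof -
      have "sqrt n = exp (ln n / 2)" using n1 by (simp add: ln_sqrt[symmetric])
      hence "sqrt n ^ (p - 1) = exp (real (p - 1) * (ln n / 2))" by (simp only: exp_of_nat_mult)
      thus ?thesis using p0 by (simp add: of_nat_diff)
    qed
    have e4: "(\<delta> * real p ^ n * exp (- U)) ^ p = \<delta> ^ p * exp (real p * (n * ln p - U))"
      unfolding e1 mult.assoc power_mult_distrib exp_of_nat_mult exp_diff by (simp add: exp_minus field_simps)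
    have lnp: "ln (real (p\<^sup>2)) = 2 * ln p" using p0 by (simp add: ln_realpow)
    \<comment> \<open>All powers of \<open>n\<close> cancel: \<open>p * (p - 1) / 2\<close> from the
      numbers of profiles and \<open>(p - 1) / 2\<close> from the free parameters match
      \<open>(p\<^sup>2 - 1) / 2\<close> in \<open>L\<close>.\<close>
    have "- ?E + 2 * n * ln p = real p * (n * ln p - U) + ((real p - 1) * (ln n / 2) + L)"
      unfolding U_def L_def lnp by (simp add: field_simps power2_eq_square power4_eq_xxxx)
    thus ?thesis unfolding e4 e2 e3 by (simp add: mult.assoc flip: exp_add)
  qed
  also have "\<dots> \<le> (\<Prod>j\<in>{1..p}. real (card (W j))) * (sqrt n ^ (p - 1) * exp L)"
  proof (rule mult_right_mono)
    have "(\<Prod>j\<in>{1..p}. \<delta> * real p ^ n * exp (- U)) \<le> (\<Prod>j\<in>{1..p}. real (card (W j)))"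
      using cW \<delta> by (intro prod_mono) auto
    thus "(\<delta> * real p ^ n * exp (- U)) ^ p \<le> (\<Prod>j\<in>{1..p}. real (card (W j)))" by simp
  qed simp
  also have "\<dots> = (\<Sum>w\<in>PiE {1..p} W. sqrt n ^ (p - 1) * exp L)"
    by (simp add: card_PiE)
  also have "\<dots> \<le> (\<Sum>w\<in>PiE {1..p} W. real (card (T w)))" by (rule sum_mono[OF low])
  also have "\<dots> = card (\<Union>w\<in>PiE {1..p} W. T w)"
    using finP finT disj by (subst card_UN_disjoint) auto
  also have "\<dots> \<le> card {z \<in> ?Z. \<forall>j\<in>{1..p}. ap_vec p n z j \<in> G j}"
    by (intro of_nat_mono card_mono UN_least sub) (use finZ in simp)
  finally show ?thesis .
qed

section \<open>Probabilities as counts, and sets of large density\<close>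

lemma card_PiE_square: "card ({..<n} \<rightarrow>\<^sub>E residues_mod p \<times> residues_mod p) = p ^ (2 * n)"
  by (simp add: card_PiE power_mult power2_eq_square)

lemma components_mem_Fp_vec:
  assumes "z \<in> {..<n} \<rightarrow>\<^sub>E residues_mod p \<times> residues_mod p"
  shows "(\<lambda>i\<in>{..<n}. fst (z i)) \<in> Fp_vec p n" and "(\<lambda>i\<in>{..<n}. snd (z i)) \<in> Fp_vec p n"
proof -
  have "fst (z i) \<in> residues_mod p" "snd (z i) \<in> residues_mod p" if "i \<in> {..<n}" for i
    using PiE_mem[OF assms that] unfolding mem_Times_iff by blast+
  thus "(\<lambda>i\<in>{..<n}. fst (z i)) \<in> Fp_vec p n" and "(\<lambda>i\<in>{..<n}. snd (z i)) \<in> Fp_vec p n"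
    unfolding Fp_vec_eq_PiE by (intro PiE_I; simp)+
qed

text \<open>Transposing a pair of vectors into a vector of pairs is a bijection that carries
  \<open>ap_term\<close> to \<open>ap_vec\<close>.\<close>

lemma prob_random_ap:
  assumes "p > 0"
  shows "measure_pmf.prob (random_ap p n) E =
    card {z \<in> {..<n} \<rightarrow>\<^sub>E residues_mod p \<times> residues_mod p. ap_vec p n z \<in> E} / real p ^ (2 * n)"
proof -
  let ?F = "Fp_vec p n" and ?Z = "{..<n} \<rightarrow>\<^sub>E residues_mod p \<times> residues_mod p"
  let ?f = "\<lambda>(x, d). ap_term p n x d"
  define g where "g z = (\<lambda>i\<in>{..<n}. fst (z i), \<lambda>i\<in>{..<n}. snd (z i))" for z :: "nat \<Rightarrow> int \<times> int"
  have fg: "?f (g z) = ap_vec p n z" for z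
    by (auto simp: fun_eq_iff g_def ap_vec_def ap_term_def ap_coord_def residue_ring_def mod_add_right_eq)
  have "bij_betw g {z \<in> ?Z. ap_vec p n z \<in> E} (?F \<times> ?F \<inter> ?f -` E)"
  proof (rule bij_betwI')
    fix y z assume yz: "y \<in> {z \<in> ?Z. ap_vec p n z \<in> E}" "z \<in> {z \<in> ?Z. ap_vec p n z \<in> E}"
    show "(g y = g z) = (y = z)"
    proof
      assume g: "g y = g z"
      have "y i = z i" if "i \<in> {..<n}" for i
        using fun_cong[OF arg_cong[OF g, of fst], of i] fun_cong[OF arg_cong[OF g, of snd], of i] that
        by (simp add: g_def prod_eq_iff)
      thus "y = z" using yz by (intro PiE_ext[of y "{..<n}" _ z]) auto
    qed simp
  next
    fix z assume z: "z \<in> {z \<in> ?Z. ap_vec p n z \<in> E}"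
    have "g z \<in> ?F \<times> ?F" using z components_mem_Fp_vec[of z n p] by (simp add: g_def)
    thus "g z \<in> ?F \<times> ?F \<inter> ?f -` E" using z fg[of z] by auto
  next
    fix xd assume xd: "xd \<in> ?F \<times> ?F \<inter> ?f -` E"
    obtain x d where [simp]: "xd = (x, d)" by fastforce
    define z where "z = (\<lambda>i\<in>{..<n}. (x i, d i))"
    have z: "z \<in> ?Z" using xd by (auto simp: z_def Fp_vec_eq_PiE)
    have "g z = (restrict x {..<n}, restrict d {..<n})"
      by (simp add: g_def z_def cong: restrict_cong)
    also have "\<dots> = xd"
      using xd PiE_restrict[of x "{..<n}" "\<lambda>_. residues_mod p"]
        PiE_restrict[of d "{..<n}" "\<lambda>_. residues_mod p"] by (simp add: Fp_vec_eq_PiE)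
    finally have "g z = xd" .
    thus "\<exists>z\<in>{z \<in> ?Z. ap_vec p n z \<in> E}. xd = g z" using z xd fg[of z] by (intro bexI[of _ z]) auto
  qed
  hence card: "card {z \<in> ?Z. ap_vec p n z \<in> E} = card (?F \<times> ?F \<inter> ?f -` E)"
    by (rule bij_betw_same_card)
  have "measure_pmf.prob (random_ap p n) E = measure_pmf.prob (pmf_of_set (?F \<times> ?F)) (?f -` E)"
    unfolding random_ap_def by (rule measure_map_pmf)
  also have "\<dots> = card (?F \<times> ?F \<inter> ?f -` E) / card (?F \<times> ?F)"
    using assms by (intro measure_pmf_of_set) (auto simp: finite_Fp_vec Fp_vec_nonempty)
  also have "card (?F \<times> ?F) = p ^ (2 * n)"
    by (simp add: card_cartesian_product card_Fp_vec power_mult power2_eq_square power_mult_distrib)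
  finally show ?thesis by (simp add: card)
qed

text \<open>Each single term of a uniform progression is uniform: the \<open>j\<close>-th term
  together with the difference determines the progression, and every such pair occurs.\<close>

lemma card_ap_vec_mem:
  assumes p: "p > 0" and S: "S \<subseteq> Fp_vec p n"
  shows "card {z \<in> {..<n} \<rightarrow>\<^sub>E residues_mod p \<times> residues_mod p. ap_vec p n z j \<in> S} = card S * p ^ n"
proof -
  let ?F = "Fp_vec p n" and ?Z = "{..<n} \<rightarrow>\<^sub>E residues_mod p \<times> residues_mod p"
  define g where "g z = (ap_vec p n z j, \<lambda>i\<in>{..<n}. snd (z i))" for z :: "nat \<Rightarrow> int \<times> int"
  have inj: "inj_on g ?Z"
  proof (rule inj_onI)
    fix y z assume yz: "y \<in> ?Z" "z \<in> ?Z" and g: "g y = g z"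
    have "y i = z i" if i: "i \<in> {..<n}" for i
    proof -
      have "(ap_coord p j (y i), snd (y i)) = (ap_coord p j (z i), snd (z i))"
        using fun_cong[OF arg_cong[OF g, of fst], of i] fun_cong[OF arg_cong[OF g, of snd], of i] i
        by (simp add: g_def ap_vec_def)
      thus ?thesis
        by (rule inj_onD[OF bij_betw_imp_inj_on[OF ap_coord_snd_bij[OF p, of j]], of "y i" "z i"])
          (rule PiE_mem[OF yz(1) i] PiE_mem[OF yz(2) i])+
    qed
    thus "y = z" by (rule PiE_ext[OF yz])
  qed
  have sub: "g ` ?Z \<subseteq> ?F \<times> ?F"
    using ap_vec_mem[OF p] components_mem_Fp_vec by (intro image_subsetI) (simp add: g_def)
  have "g ` ?Z = ?F \<times> ?F"
  proof (rule card_subset_eq[OF _ sub])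
    show "card (g ` ?Z) = card (?F \<times> ?F)"
      unfolding card_image[OF inj] card_PiE_square
      by (simp add: card_cartesian_product card_Fp_vec power_mult power2_eq_square power_mult_distrib)
  qed (simp add: finite_Fp_vec)
  have "g ` {z \<in> ?Z. ap_vec p n z j \<in> S} = S \<times> ?F"
  proof (intro equalityI subsetI)
    fix y assume "y \<in> g ` {z \<in> ?Z. ap_vec p n z j \<in> S}"
    thus "y \<in> S \<times> ?F" using components_mem_Fp_vec(2)[of _ n p] by (force simp: g_def)
  next
    fix y assume y: "y \<in> S \<times> ?F"
    hence "y \<in> g ` ?Z" using \<open>g ` ?Z = ?F \<times> ?F\<close> S by blast
    then obtain z where z: "z \<in> ?Z" "y = g z" by blast
    hence "ap_vec p n z j \<in> S" using y by (simp add: g_def)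
    thus "y \<in> g ` {z \<in> ?Z. ap_vec p n z j \<in> S}" using z by blast
  qed
  hence "card (S \<times> ?F) = card (g ` {z \<in> ?Z. ap_vec p n z j \<in> S})" by simp
  also have "\<dots> = card {z \<in> ?Z. ap_vec p n z j \<in> S}"
    by (rule card_image, rule inj_on_subset[OF inj]) blast
  finally show ?thesis by (simp add: card_cartesian_product card_Fp_vec)
qed

text \<open>If all densities exceeded \<open>\<mu>\<close>, a union bound over the complements would
  make the probability at least \<open>1 - p * (1 - \<mu>)\<close>. So some set is sparse enough to
  be removed entirely, which leaves no progression.\<close>

lemma removal_large_density:
  fixes \<mu> :: real
  assumes p: "p > 0" and \<mu>: "\<mu> > 0" and sym: "\<And>j. j \<in> {1..p} \<Longrightarrow> symmetric_set p n (S j)"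
    and prob: "measure_pmf.prob (random_ap p n) {X. \<forall>j\<in>{1..p}. X j \<in> S j} < 1 - p * (1 - \<mu>)"
  shows "\<exists>S'. (\<forall>j\<in>{1..p}. symmetric_set p n (S' j) \<and> set_density p n (S' j) \<le> \<mu>) \<and>
    measure_pmf.prob (random_ap p n) {X. \<forall>j\<in>{1..p}. X j \<in> S j - S' j} = 0"
proof -
  let ?Z = "{..<n} \<rightarrow>\<^sub>E residues_mod p \<times> residues_mod p"
  let ?bad = "\<lambda>j. {z \<in> ?Z. ap_vec p n z j \<notin> S j}"
  have finZ: "finite ?Z" by (rule finite_PiE) auto
  have "\<exists>j\<in>{1..p}. set_density p n (S j) \<le> \<mu>"
  proof (rule ccontr)
    assume "\<not> ?thesis"
    hence dens: "\<mu> < set_density p n (S j)" if "j \<in> {1..p}" for j using that by force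
    have bad: "real (card (?bad j)) \<le> (1 - \<mu>) * real p ^ (2 * n)" if j: "j \<in> {1..p}" for j
    proof -
      have "real (card (?bad j)) = real (card ?Z) - real (card {z \<in> ?Z. ap_vec p n z j \<in> S j})"
      proof -
        have "?Z = ?bad j \<union> {z \<in> ?Z. ap_vec p n z j \<in> S j}" by blast
        hence "card ?Z = card (?bad j) + card {z \<in> ?Z. ap_vec p n z j \<in> S j}"
          using finZ by (subst card_Un_disjoint[symmetric]) auto
        thus ?thesis by linarith
      qed
      also have "\<dots> = real p ^ (2 * n) - real (card (S j)) * real p ^ n"
        using card_ap_vec_mem[OF p, of "S j" n j] sym[OF j] card_PiE_square[of n p]
        by (simp add: symmetric_set_def)
      also have "real (card (S j)) = set_density p n (S j) * real p ^ n"
        using p by (simp add: set_density_def)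
      also have "real p ^ (2 * n) - set_density p n (S j) * real p ^ n * real p ^ n
          = (1 - set_density p n (S j)) * real p ^ (2 * n)"
        unfolding mult_2 power_add by (simp add: algebra_simps)
      also have "\<dots> \<le> (1 - \<mu>) * real p ^ (2 * n)"
        using dens[OF j] by (intro mult_right_mono) auto
      finally show ?thesis .
    qed
    let ?good = "{z \<in> ?Z. ap_vec p n z \<in> {X. \<forall>j\<in>{1..p}. X j \<in> S j}}"
    have "card ?Z \<le> card (?good \<union> (\<Union>j\<in>{1..p}. ?bad j))"
      using finZ by (intro card_mono) auto
    also have "\<dots> \<le> card ?good + (\<Sum>j\<in>{1..p}. card (?bad j))"
      by (rule card_Un_le[THEN order_trans]) (intro add_left_mono card_UN_le, simp)
    finally have "real (card ?Z) \<le> real (card ?good + (\<Sum>j\<in>{1..p}. card (?bad j)))"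
      by (subst of_nat_le_iff)
    also have "\<dots> = real (card ?good) + (\<Sum>j\<in>{1..p}. real (card (?bad j)))" by simp
    also have "(\<Sum>j\<in>{1..p}. real (card (?bad j))) \<le> (\<Sum>j\<in>{1..p}. (1 - \<mu>) * real p ^ (2 * n))"
      by (rule sum_mono[OF bad])
    also have "\<dots> = p * (1 - \<mu>) * real p ^ (2 * n)" by simp
    finally have "(1 - p * (1 - \<mu>)) * real p ^ (2 * n) \<le> card ?good"
      unfolding card_PiE_square by (simp add: algebra_simps)
    hence "1 - p * (1 - \<mu>) \<le> card ?good / real p ^ (2 * n)" using p by (simp add: field_simps)
    thus False using prob unfolding prob_random_ap[OF p] by linarith
  qed
  then obtain j0 where j0: "j0 \<in> {1..p}" "set_density p n (S j0) \<le> \<mu>" by blast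
  define S' where "S' j = (if j = j0 then S j else {})" for j
  have "symmetric_set p n (S' j) \<and> set_density p n (S' j) \<le> \<mu>" if "j \<in> {1..p}" for j
    using sym[OF that] j0 \<mu> by (auto simp: S'_def symmetric_set_def set_density_def)
  moreover have "measure_pmf.prob (random_ap p n) {X. \<forall>j\<in>{1..p}. X j \<in> S j - S' j} = 0"
  proof -
    have "{X. \<forall>j\<in>{1..p}. X j \<in> S j - S' j} = {}" using j0 by (auto simp: S'_def)
    thus ?thesis by (simp only: measure_empty)
  qed
  ultimately show ?thesis by blast
qed

lemma card_atypical:
  fixes A :: real
  assumes p: "p > 0" and A: "0 < A" "A \<le> 2 * sqrt n"
  shows "card {x \<in> Fp_vec p n. \<exists>a\<in>residues_mod p. \<bar>weight n a x - real n / p\<bar> > A * sqrt n}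
    \<le> 2 * real p * exp (- A\<^sup>2 / 4) * real p ^ n"
proof -
  let ?B = "\<lambda>a. {x \<in> Fp_vec p n. \<bar>weight n a x - real n / p\<bar> > A * sqrt n}"
  have "{x \<in> Fp_vec p n. \<exists>a\<in>residues_mod p. \<bar>weight n a x - real n / p\<bar> > A * sqrt n} = (\<Union>a\<in>residues_mod p. ?B a)"
    by blast
  hence "real (card {x \<in> Fp_vec p n. \<exists>a\<in>residues_mod p. \<bar>weight n a x - real n / p\<bar> > A * sqrt n})
      \<le> real (\<Sum>a\<in>residues_mod p. card (?B a))"
    by (simp only: of_nat_le_iff) (rule card_UN_le, simp)
  also have "\<dots> = (\<Sum>a\<in>residues_mod p. real (card (?B a)))" by simp
  also have "\<dots> \<le> (\<Sum>a\<in>residues_mod p. 2 * exp (- A\<^sup>2 / 4) * real p ^ n)"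
    unfolding Fp_vec_eq_PiE weight_def
    by (intro sum_mono PiE_count_tail A) auto
  also have "\<dots> = 2 * real p * exp (- A\<^sup>2 / 4) * real p ^ n" by simp
  finally show ?thesis .
qed

section \<open>Removal\<close>

text \<open>The fibres of this map within a set are the units of removal: compatibility of
  \<open>p\<close> terms depends on weights only modulo \<open>p\<close>.\<close>

definition residue_profile :: "nat \<Rightarrow> nat \<Rightarrow> (nat \<Rightarrow> int) \<Rightarrow> int \<Rightarrow> nat" where
  "residue_profile p n x = (\<lambda>a\<in>residues_mod p. weight n a x mod p)"

text \<open>Serves both for the removed sets and for the typical parts of the classes that
  remain.\<close>

lemma symmetric_set_filter:
  assumes "symmetric_set p n S" and "\<And>x y. x \<in> S \<Longrightarrow> y \<in> S \<Longrightarrow> profile p n x = profile p n y \<Longrightarrow> P x = P y"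
  shows "symmetric_set p n {x \<in> S. P x}"
  unfolding symmetric_set_def
proof (intro conjI ballI impI)
  show "{x \<in> S. P x} \<subseteq> Fp_vec p n" using assms(1) by (auto simp: symmetric_set_def)
  fix x y assume xy: "x \<in> Fp_vec p n" "y \<in> Fp_vec p n"
    "\<forall>a\<in>carrier (residue_ring (int p)). weight n a x = weight n a y"
  hence pr: "profile p n x = profile p n y"
    unfolding profile_def carrier_residue_ring_int by (intro restrict_ext) (rule bspec)
  have "x \<in> S \<longleftrightarrow> y \<in> S" using assms(1) xy unfolding symmetric_set_def by blast
  moreover have "P x = P y" if "x \<in> S" "y \<in> S" by (rule assms(2)[OF that pr])
  ultimately show "x \<in> {x \<in> S. P x} \<longleftrightarrow> y \<in> {x \<in> S. P x}" by blast
qed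

lemma profile_cong:
  assumes "profile p n x = profile p n y" and "a \<in> residues_mod p"
  shows "weight n a x = weight n a y"
  using fun_cong[OF assms(1), of a] assms(2) by (simp add: profile_def)

lemma residue_profile_cong:
  assumes "profile p n x = profile p n y"
  shows "residue_profile p n x = residue_profile p n y"
  unfolding residue_profile_def by (rule restrict_ext) (simp only: profile_cong[OF assms])

text \<open>There are at most \<open>p ^ p\<close> residue profiles, and each small class
  contributes at most \<open>t\<close> elements.\<close>

lemma card_union_small_classes:
  fixes t :: real
  assumes p: "p > 0" and S: "finite S" and t: "t \<ge> 0"
  shows "card {x \<in> S. card {y \<in> S. residue_profile p n y = residue_profile p n x} \<le> t} \<le> real p ^ p * t"
proof -
  let ?S' = "{x \<in> S. card {y \<in> S. residue_profile p n y = residue_profile p n x} \<le> t}"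
  let ?R = "residues_mod p \<rightarrow>\<^sub>E {..<p}"
  have finR: "finite ?R" by (rule finite_PiE) auto
  have "residue_profile p n ` ?S' \<subseteq> ?R"
    using p by (intro image_subsetI) (simp add: residue_profile_def)
  hence "card ?S' = (\<Sum>r\<in>?R. card {x \<in> ?S'. residue_profile p n x = r})"
    using sum.group[of ?S' ?R "residue_profile p n" "\<lambda>_. 1 :: nat"] finR S by simp
  hence "real (card ?S') = (\<Sum>r\<in>?R. real (card {x \<in> ?S'. residue_profile p n x = r}))" by simp
  also have "\<dots> \<le> (\<Sum>r\<in>?R. t)"
  proof (rule sum_mono)
    fix r
    show "card {x \<in> ?S'. residue_profile p n x = r} \<le> t"
    proof (cases "{x \<in> ?S'. residue_profile p n x = r} = {}")
      case True
      thus ?thesis using t by (simp only: card.empty)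
    next
      case False
      then obtain x where x: "x \<in> ?S'" "residue_profile p n x = r" by blast
      have "card {x \<in> ?S'. residue_profile p n x = r} \<le> card {y \<in> S. residue_profile p n y = residue_profile p n x}"
        using S x(2) by (intro card_mono) auto
      also have "real \<dots> \<le> t" using x(1) by blast
      finally show ?thesis by simp
    qed
  qed
  also have "\<dots> = real p ^ p * t" by (simp add: card_PiE)
  finally show ?thesis .
qed

text \<open>A progression surviving the removal has every term in a class of density above
  \<open>2 * \<delta>\<close>, hence with typical part of density at least \<open>\<delta>\<close>.
  That progression certifies compatible residues, so the count of progressions through the typical
  parts contradicts the small probability.\<close>

lemma removal_small_density:
  assumes p: "prime p"
  shows "\<exists>(c::real) (D::nat). 0 < c \<and> c < 1 \<and>
    (\<forall>\<mu>. 0 < \<mu> \<and> \<mu> < 1 \<longrightarrow> (\<exists>n0. \<forall>n\<ge>n0. \<forall>S. (\<forall>j\<in>{1..p}. symmetric_set p n (S j)) \<and>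
      measure_pmf.prob (random_ap p n) {X. \<forall>j\<in>{1..p}. X j \<in> S j} < c * \<mu> ^ D \<longrightarrow>
      (\<exists>S'. (\<forall>j\<in>{1..p}. symmetric_set p n (S' j) \<and> set_density p n (S' j) \<le> \<mu>) \<and>
        measure_pmf.prob (random_ap p n) {X. \<forall>j\<in>{1..p}. X j \<in> S j - S' j} = 0)))"
proof -
  have p2: "p \<ge> 2" using p prime_ge_2_nat by blast
  hence p0: "p > 0" by simp
  \<comment> \<open>\<open>K\<close> collects the parts of \<open>E\<close> that do not depend on
    \<open>\<mu>\<close>, after
    \<open>(A + 2 * p)\<^sup>2 \<le> 2 * A\<^sup>2 + 8 * p\<^sup>2\<close>; the last summand is
    \<open>p ^ 4 * (8 * p\<^sup>2)\<close>.\<close>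
  define K where "K = real p + real p ^ 2 + real p ^ 2 / 2 * ln (2 * real p) + 8 * real p ^ 6"
  \<comment> \<open>The remaining part of \<open>E\<close> is
    \<open>8 * p ^ 4 * ln (2 * p / \<delta>)\<close>, a power of \<open>\<delta> / (2 * p)\<close>.
    Pulling \<open>\<mu>\<close> out of the powers of \<open>\<delta>\<close> leaves
    \<open>c\<close> and the exponent \<open>D\<close>.\<close>
  define c where "c = (1 / (2 * real p ^ p)) ^ p * exp (- K) * (1 / (4 * real p ^ p * real p)) ^ (8 * p ^ 4)"
  define D where "D = p + 8 * p ^ 4"
  have K: "K > 0" using p2 by (simp add: K_def add_pos_nonneg)
  have c0: "0 < c" using p0 by (simp add: c_def)
  have c1: "c < 1"
  proof -
    have pp: "real p ^ p \<ge> 1" "real p ^ p * real p \<ge> 1" using p0 by (auto intro!: mult_ge1_I)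
    have "(1 / (2 * real p ^ p)) ^ p \<le> 1" using pp by (intro power_le_one) (auto simp: divide_le_eq)
    moreover have "(1 / (4 * real p ^ p * real p)) ^ (8 * p ^ 4) \<le> 1" using pp by (intro power_le_one) (auto simp: divide_le_eq mult.assoc)
    ultimately have "c \<le> 1 * exp (- K) * 1"
      unfolding c_def by (intro mult_mono) auto
    also have "\<dots> < 1" using K by simp
    finally show ?thesis .
  qed
  show ?thesis
  proof (rule exI[of _ c], rule exI[of _ D], intro conjI[OF c0] conjI[OF c1] allI impI)
    fix \<mu> :: real assume "0 < \<mu> \<and> \<mu> < 1"
    hence \<mu>: "0 < \<mu>" "\<mu> < 1" by auto
    \<comment> \<open>Twice \<open>\<delta>\<close> is the removal threshold
      \<open>\<mu> / p ^ p\<close>; the atypical vectors use up half of it.\<close>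
    define \<delta> where "\<delta> = \<mu> / (2 * real p ^ p)"
    \<comment> \<open>Chosen so that the Chernoff bound \<open>2 * p * exp (- A\<^sup>2 / 4)\<close>
      for atypical vectors equals \<open>\<delta>\<close>.\<close>
    define A where "A = 2 * sqrt (ln (2 * real p / \<delta>))"
    have pp: "real p ^ p \<ge> 1" using p0 by simp
    have \<delta>: "0 < \<delta>" "\<delta> \<le> 1 / 2"
    proof -
      show "0 < \<delta>" using \<mu> p0 by (simp add: \<delta>_def)
      have "\<mu> * 2 \<le> 2 * real p ^ p" using \<mu> pp by linarith
      thus "\<delta> \<le> 1 / 2" using p0 by (simp add: \<delta>_def field_simps)
    qed
    have ln1: "ln (2 * real p / \<delta>) \<ge> 1"
    proof -
      have "3 * \<delta> \<le> 2 * real p" using \<delta> p2 by linarith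
      hence "3 \<le> 2 * real p / \<delta>" using \<delta> by (simp add: field_simps)
      hence "exp 1 \<le> 2 * real p / \<delta>" using exp_le by linarith
      thus ?thesis using \<delta> p0 by (subst ln_ge_iff) auto
    qed
    have A2: "A\<^sup>2 = 4 * ln (2 * real p / \<delta>)" using ln1 by (simp add: A_def power_mult_distrib)
    have "1 \<le> sqrt (ln (2 * real p / \<delta>))" using ln1 by simp
    hence A1: "A \<ge> 1" unfolding A_def by linarith
    have eA: "2 * real p * exp (- A\<^sup>2 / 4) = \<delta>"
      using \<delta> p0 unfolding A2 by (simp add: exp_minus)
    obtain m :: nat where m: "real m \<ge> (real p)\<^sup>2 * (A + 4 * real p)" using real_arch_simple by blast
    define E where "E = real p + real p ^ 2 + real p ^ 2 / 2 * ln (2 * real p) + real p ^ 4 * (A + 2 * real p)\<^sup>2"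
    have lower: "c * \<mu> ^ D \<le> \<delta> ^ p * exp (- E)"
    proof -
      have "(A + 2 * real p)\<^sup>2 \<le> 2 * A\<^sup>2 + 8 * (real p)\<^sup>2"
        using zero_le_power2[of "A - 2 * real p"] by (simp add: power2_eq_square algebra_simps)
      hence "real p ^ 4 * (A + 2 * real p)\<^sup>2 \<le> real p ^ 4 * (2 * A\<^sup>2 + 8 * (real p)\<^sup>2)"
        by (intro mult_left_mono) auto
      also have "\<dots> = 8 * real p ^ 4 * ln (2 * real p / \<delta>) + 8 * real p ^ 6"
        unfolding A2 by (simp add: algebra_simps flip: power_add)
      finally have "E \<le> K + 8 * real p ^ 4 * ln (2 * real p / \<delta>)" by (simp add: E_def K_def)
      hence bound: "exp (- (K + 8 * real p ^ 4 * ln (2 * real p / \<delta>))) \<le> exp (- E)" by simp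
      have eq: "exp (- (K + 8 * real p ^ 4 * ln (2 * real p / \<delta>))) = exp (- K) * (\<delta> / (2 * real p)) ^ (8 * p ^ 4)"
      proof -
        have "ln (2 * real p / \<delta>) = - ln (\<delta> / (2 * real p))" using \<delta> p0 by (simp add: ln_div)
        hence "- (K + 8 * real p ^ 4 * ln (2 * real p / \<delta>)) = - K + real (8 * p ^ 4) * ln (\<delta> / (2 * real p))"
          by simp
        thus ?thesis using \<delta> p0 by (simp only: exp_add exp_of_nat_mult) simp
      qed
      have "\<delta> ^ p * (exp (- K) * (\<delta> / (2 * real p)) ^ (8 * p ^ 4)) \<le> \<delta> ^ p * exp (- E)"
        using bound \<delta> unfolding eq by (intro mult_left_mono) auto
      moreover have "\<delta> ^ p * (exp (- K) * (\<delta> / (2 * real p)) ^ (8 * p ^ 4)) = c * \<mu> ^ D"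
      proof -
        have "\<delta> = \<mu> * (1 / (2 * real p ^ p))" "\<delta> / (2 * real p) = \<mu> * (1 / (4 * real p ^ p * real p))"
          by (simp_all add: \<delta>_def)
        moreover have "(\<mu> * a) ^ p * (e * (\<mu> * b) ^ N) = (a ^ p * e * b ^ N) * \<mu> ^ (p + N)"
          for a b e :: real and N
          by (simp add: power_mult_distrib power_add)
        ultimately show ?thesis unfolding c_def D_def by (simp only:)
      qed
      ultimately show ?thesis by simp
    qed
    show "\<exists>n0. \<forall>n\<ge>n0. \<forall>S. (\<forall>j\<in>{1..p}. symmetric_set p n (S j)) \<and>
      measure_pmf.prob (random_ap p n) {X. \<forall>j\<in>{1..p}. X j \<in> S j} < c * \<mu> ^ D \<longrightarrow>
      (\<exists>S'. (\<forall>j\<in>{1..p}. symmetric_set p n (S' j) \<and> set_density p n (S' j) \<le> \<mu>) \<and>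
        measure_pmf.prob (random_ap p n) {X. \<forall>j\<in>{1..p}. X j \<in> S j - S' j} = 0)"
    proof (intro exI[of _ "m ^ 2"] allI impI, elim conjE)
      fix n and S :: "nat \<Rightarrow> (nat \<Rightarrow> int) set"
      assume n: "n \<ge> m ^ 2" and sym: "\<forall>j\<in>{1..p}. symmetric_set p n (S j)"
        and prob: "measure_pmf.prob (random_ap p n) {X. \<forall>j\<in>{1..p}. X j \<in> S j} < c * \<mu> ^ D"
      let ?Z = "{..<n} \<rightarrow>\<^sub>E residues_mod p \<times> residues_mod p"
      have finZ: "finite ?Z" by (rule finite_PiE) auto
      have "real m \<le> sqrt n" using n by (intro real_le_rsqrt) (simp flip: of_nat_power)
      hence nm: "sqrt n \<ge> (real p)\<^sup>2 * (A + 4 * real p)" using m by linarith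
      have "A \<le> 1 * (A + 4 * real p)" by simp
      also have "\<dots> \<le> (real p)\<^sup>2 * (A + 4 * real p)" using p0 A1 by (intro mult_right_mono) auto
      finally have An: "A \<le> 2 * sqrt n" using nm real_sqrt_ge_zero[of "real n"] by linarith
      define t where "t = 2 * \<delta> * real p ^ n"
      have t: "t \<ge> 0" using \<delta> by (simp add: t_def)
      define S' where "S' j = {x \<in> S j. card {y \<in> S j. residue_profile p n y = residue_profile p n x} \<le> t}" for j
      have Sfin: "finite (S j)" "S j \<subseteq> Fp_vec p n" if "j \<in> {1..p}" for j
      proof -
        show "S j \<subseteq> Fp_vec p n" using sym that by (simp add: symmetric_set_def)
        thus "finite (S j)" using finite_Fp_vec by (rule finite_subset)
      qed
      have "symmetric_set p n (S' j) \<and> set_density p n (S' j) \<le> \<mu>" if j: "j \<in> {1..p}" for j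
      proof
        show "symmetric_set p n (S' j)"
          unfolding S'_def
        proof (rule symmetric_set_filter)
          show "symmetric_set p n (S j)" using sym j by blast
          fix x y assume "profile p n x = profile p n y"
          hence "residue_profile p n x = residue_profile p n y" by (rule residue_profile_cong)
          thus "(card {z \<in> S j. residue_profile p n z = residue_profile p n x} \<le> t) =
              (card {z \<in> S j. residue_profile p n z = residue_profile p n y} \<le> t)" by (simp only:)
        qed
        have "card (S' j) \<le> real p ^ p * t"
          unfolding S'_def by (rule card_union_small_classes[OF p0 Sfin(1)[OF j] t])
        also have "\<dots> = \<mu> * real p ^ n" using p0 by (simp add: t_def \<delta>_def)
        finally show "set_density p n (S' j) \<le> \<mu>" using p0 by (simp add: set_density_def field_simps)
      qed
      moreover have "measure_pmf.prob (random_ap p n) {X. \<forall>j\<in>{1..p}. X j \<in> S j - S' j} = 0"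
      proof (rule ccontr)
        assume "\<not> ?thesis"
        hence "{z \<in> ?Z. ap_vec p n z \<in> {X. \<forall>j\<in>{1..p}. X j \<in> S j - S' j}} \<noteq> {}"
          unfolding prob_random_ap[OF p0] by (metis card.empty div_0 of_nat_0)
        then obtain z0 where z0: "z0 \<in> ?Z" "\<And>j. j \<in> {1..p} \<Longrightarrow> ap_vec p n z0 j \<in> S j - S' j" by blast
        \<comment> \<open>The typical part of the class containing the \<open>j\<close>-th term of
          \<open>z0\<close>. This class was not removed, so it has more than \<open>t\<close>
          elements.\<close>
        define G where "G j = {y \<in> S j. residue_profile p n y = residue_profile p n (ap_vec p n z0 j) \<and>
            (\<forall>a\<in>residues_mod p. \<bar>weight n a y - real n / p\<bar> \<le> A * sqrt n)}" for j
        have "\<delta> ^ p * exp (- E) * real p ^ (2 * n) \<le> card {z \<in> ?Z. \<forall>j\<in>{1..p}. ap_vec p n z j \<in> G j}"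
          unfolding E_def
        proof (rule ap_count_typical_lower[OF p z0(1) A1 nm])
          show "0 \<le> \<delta>" using \<delta> by simp
        next
          fix j assume j: "j \<in> {1..p}"
          show "symmetric_set p n (G j)" unfolding G_def
          proof (rule symmetric_set_filter)
            show "symmetric_set p n (S j)" using sym j by blast
            fix x y assume "profile p n x = profile p n y"
            thus "(residue_profile p n x = residue_profile p n (ap_vec p n z0 j) \<and>
                (\<forall>a\<in>residues_mod p. \<bar>weight n a x - real n / p\<bar> \<le> A * sqrt n)) =
              (residue_profile p n y = residue_profile p n (ap_vec p n z0 j) \<and>
                (\<forall>a\<in>residues_mod p. \<bar>weight n a y - real n / p\<bar> \<le> A * sqrt n))"
              using residue_profile_cong[of p n x y] profile_cong[of p n x y] by simp
          qed
          show "weight n a x mod p = weight n a (ap_vec p n z0 j) mod p"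
            if "x \<in> G j" "a \<in> residues_mod p" for x a
          proof -
            have "residue_profile p n x = residue_profile p n (ap_vec p n z0 j)"
              using that(1) by (simp add: G_def)
            from fun_cong[OF this, of a] that(2) show ?thesis by (simp add: residue_profile_def)
          qed
          show "\<bar>weight n a x - real n / p\<bar> \<le> A * sqrt n" if "x \<in> G j" "a \<in> residues_mod p" for x a
            using that unfolding G_def by blast
          let ?C = "{y \<in> S j. residue_profile p n y = residue_profile p n (ap_vec p n z0 j)}"
          let ?N = "{x \<in> Fp_vec p n. \<exists>a\<in>residues_mod p. \<bar>weight n a x - real n / p\<bar> > A * sqrt n}"
          have "t < card ?C" using z0(2)[OF j] by (simp add: S'_def not_le)
          also have "card ?C \<le> card (G j \<union> ?N)"
          proof (rule card_mono)
            show "finite (G j \<union> ?N)" using Sfin(1)[OF j] finite_Fp_vec[of p n] by (simp add: G_def)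
            show "?C \<subseteq> G j \<union> ?N"
            proof
              fix y assume y: "y \<in> ?C"
              show "y \<in> G j \<union> ?N"
              proof (cases "\<exists>a\<in>residues_mod p. \<bar>weight n a y - real n / p\<bar> > A * sqrt n")
                case True
                thus ?thesis using y Sfin(2)[OF j] by blast
              next
                case False
                hence "\<forall>a\<in>residues_mod p. \<bar>weight n a y - real n / p\<bar> \<le> A * sqrt n" by (meson not_less)
                thus ?thesis using y unfolding G_def by blast
              qed
            qed
          qed
          also have "card (G j \<union> ?N) \<le> card (G j) + card ?N" by (rule card_Un_le)
          finally have "t < real (card (G j)) + real (card ?N)" by simp
          moreover have "real (card ?N) \<le> \<delta> * real p ^ n"
            using card_atypical[OF p0 _ An] A1 unfolding eA by simp
          ultimately show "\<delta> * real p ^ n \<le> card (G j)" unfolding t_def by linarith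
        qed
        also have "\<dots> \<le> card {z \<in> ?Z. ap_vec p n z \<in> {X. \<forall>j\<in>{1..p}. X j \<in> S j}}"
          using finZ by (intro of_nat_mono card_mono) (auto simp: G_def)
        finally have "\<delta> ^ p * exp (- E) \<le> card {z \<in> ?Z. ap_vec p n z \<in> {X. \<forall>j\<in>{1..p}. X j \<in> S j}} / real p ^ (2 * n)"
          using p0 by (simp add: pos_le_divide_eq)
        thus False using prob lower unfolding prob_random_ap[OF p0] by linarith
      qed
      ultimately show "\<exists>S'. (\<forall>j\<in>{1..p}. symmetric_set p n (S' j) \<and> set_density p n (S' j) \<le> \<mu>) \<and>
        measure_pmf.prob (random_ap p n) {X. \<forall>j\<in>{1..p}. X j \<in> S j - S' j} = 0"
        by blast
    qed
  qed
qed

section \<open>Combining the two ranges of the density bound\<close>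

text \<open>With \<open>x = p * (1 - \<mu>)\<close>, which is at most \<open>1/4\<close>, the power
  is at most \<open>exp (- 2 * x) \<le> 1 - 2 * x + 4 * x\<^sup>2 \<le> 1 - x\<close>.\<close>

lemma powr_le_one_minus:
  fixes \<mu> C :: real and p :: nat
  assumes p: "p > 0" and \<mu>: "1 - 1 / (4 * real p) \<le> \<mu>" "\<mu> < 1" and C: "2 * real p \<le> C"
  shows "\<mu> powr C \<le> 1 - p * (1 - \<mu>)"
proof -
  define x where "x = p * (1 - \<mu>)"
  have "1 / (4 * real p) < 1" using p by (simp add: field_simps)
  hence \<mu>0: "\<mu> > 0" using \<mu>(1) by linarith
  have x: "0 \<le> x" "x \<le> 1 / 4"
  proof -
    show "0 \<le> x" using \<mu>(2) by (simp add: x_def)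
    have "x \<le> p * (1 / (4 * real p))" unfolding x_def using \<mu>(1) by (intro mult_left_mono) auto
    thus "x \<le> 1 / 4" using p by simp
  qed
  have "\<mu> powr C \<le> \<mu> powr (2 * real p)" using \<mu>0 \<mu>(2) C by (intro powr_mono') auto
  also have "\<dots> = exp (2 * real p * ln \<mu>)" using \<mu>0 by (simp add: powr_def)
  also have "\<dots> \<le> exp (2 * real p * (\<mu> - 1))"
    using ln_le_minus_one[OF \<mu>0] p by (subst exp_le_cancel_iff) (intro mult_left_mono, auto)
  also have "2 * real p * (\<mu> - 1) = - (2 * x)" by (simp add: x_def algebra_simps)
  also have "exp (- (2 * x)) \<le> 1 + - (2 * x) + (- (2 * x))\<^sup>2" using x by (intro exp_le_quadratic) auto
  also have "\<dots> \<le> 1 - x"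
  proof -
    have "x * (4 * x) \<le> x * 1" using x by (intro mult_left_mono) auto
    thus ?thesis by (simp add: power2_eq_square)
  qed
  finally show ?thesis by (simp add: x_def)
qed

theorem theorem1:
  fixes p :: nat
  assumes "prime p" and "p \<ge> 3"
  shows "\<exists>C::real. C > 0 \<and>
    (\<forall>\<mu>::real. 0 < \<mu> \<and> \<mu> < 1 \<longrightarrow>
      (\<exists>n0::nat. \<forall>n\<ge>n0. \<forall>S :: nat \<Rightarrow> (nat \<Rightarrow> int) set.
        (\<forall>j\<in>{1..p}. symmetric_set p n (S j)) \<and>
        measure_pmf.prob (random_ap p n) {X. \<forall>j\<in>{1..p}. X j \<in> S j} < \<mu> powr C \<longrightarrow>
        (\<exists>S' :: nat \<Rightarrow> (nat \<Rightarrow> int) set.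
          (\<forall>j\<in>{1..p}. symmetric_set p n (S' j) \<and> set_density p n (S' j) \<le> \<mu>) \<and>
          measure_pmf.prob (random_ap p n) {X. \<forall>j\<in>{1..p}. X j \<in> S j - S' j} = 0)))"
proof -
  have p0: "p > 0" using assms(2) by simp
  obtain c :: real and D :: nat where c: "0 < c" "c < 1" and small:
    "\<forall>\<mu>. 0 < \<mu> \<and> \<mu> < 1 \<longrightarrow> (\<exists>n0. \<forall>n\<ge>n0. \<forall>S. (\<forall>j\<in>{1..p}. symmetric_set p n (S j)) \<and>
      measure_pmf.prob (random_ap p n) {X. \<forall>j\<in>{1..p}. X j \<in> S j} < c * \<mu> ^ D \<longrightarrow>
      (\<exists>S'. (\<forall>j\<in>{1..p}. symmetric_set p n (S' j) \<and> set_density p n (S' j) \<le> \<mu>) \<and>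
        measure_pmf.prob (random_ap p n) {X. \<forall>j\<in>{1..p}. X j \<in> S j - S' j} = 0))"
    using removal_small_density[OF assms(1)] by blast
  \<comment> \<open>From this threshold up to \<open>1\<close> the union bound applies; below it
    \<open>\<mu>\<close> stays away from \<open>1\<close>, so a constant factor can become a power
    of \<open>\<mu>\<close>.\<close>
  define \<mu>0 where "\<mu>0 = 1 - 1 / (4 * real p)"
  have \<mu>0: "0 < \<mu>0" "\<mu>0 < 1" using p0 by (auto simp: \<mu>0_def field_simps)
  \<comment> \<open>The first value serves the union bound. In the second,
    \<open>\<mu>0 powr (ln c / ln \<mu>0) = c\<close>, and the exponent is nonnegative because
    \<open>c < 1\<close>, so smaller \<open>\<mu>\<close> give at most \<open>c\<close> as
    well.\<close>
  define C where "C = max (2 * real p) (D + ln c / ln \<mu>0)"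
  show ?thesis
  proof (rule exI[of _ C], intro conjI allI impI, goal_cases)
    case 1
    show ?case using p0 by (simp add: C_def)
  next
    case (2 \<mu>)
    hence \<mu>: "0 < \<mu>" "\<mu> < 1" by auto
    show ?case
    proof (cases "\<mu>0 \<le> \<mu>")
      case True
      hence le: "\<mu> powr C \<le> 1 - p * (1 - \<mu>)"
        using p0 \<mu> by (intro powr_le_one_minus) (auto simp: \<mu>0_def C_def)
      show ?thesis
      proof (intro exI[of _ 0] allI impI, elim conjE)
        fix n and S :: "nat \<Rightarrow> (nat \<Rightarrow> int) set"
        assume sym: "\<forall>j\<in>{1..p}. symmetric_set p n (S j)"
          and prob: "measure_pmf.prob (random_ap p n) {X. \<forall>j\<in>{1..p}. X j \<in> S j} < \<mu> powr C"
        show "\<exists>S'. (\<forall>j\<in>{1..p}. symmetric_set p n (S' j) \<and> set_density p n (S' j) \<le> \<mu>) \<and>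
            measure_pmf.prob (random_ap p n) {X. \<forall>j\<in>{1..p}. X j \<in> S j - S' j} = 0"
          by (rule removal_large_density[OF p0 \<mu>(1) _ less_le_trans[OF prob le]]) (use sym in blast)
      qed
    next
      case False
      have ln\<mu>: "ln \<mu>0 < 0" "ln \<mu> \<le> ln \<mu>0" using \<mu>0 \<mu> False by auto
      have "\<mu> powr C \<le> \<mu> powr (D + ln c / ln \<mu>0)"
        using \<mu> by (intro powr_mono') (auto simp: C_def)
      also have "\<dots> = \<mu> ^ D * \<mu> powr (ln c / ln \<mu>0)" using \<mu> by (simp add: powr_add powr_realpow)
      also have "\<mu> powr (ln c / ln \<mu>0) \<le> c"
      proof -
        have "ln c / ln \<mu>0 \<ge> 0" using c ln\<mu> by (intro divide_nonpos_nonpos) auto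
        hence "ln c / ln \<mu>0 * ln \<mu> \<le> ln c / ln \<mu>0 * ln \<mu>0" using ln\<mu> by (intro mult_left_mono) auto
        also have "\<dots> = ln c" using ln\<mu> by simp
        finally have "exp (ln c / ln \<mu>0 * ln \<mu>) \<le> exp (ln c)" by simp
        thus ?thesis using \<mu> c by (simp add: powr_def)
      qed
      finally have le: "\<mu> powr C \<le> c * \<mu> ^ D" using \<mu> by (simp add: mult.commute)
      obtain n0 where n0: "\<And>n S. n \<ge> n0 \<Longrightarrow> (\<forall>j\<in>{1..p}. symmetric_set p n (S j)) \<Longrightarrow>
          measure_pmf.prob (random_ap p n) {X. \<forall>j\<in>{1..p}. X j \<in> S j} < c * \<mu> ^ D \<Longrightarrow>
          (\<exists>S'. (\<forall>j\<in>{1..p}. symmetric_set p n (S' j) \<and> set_density p n (S' j) \<le> \<mu>) \<and>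
            measure_pmf.prob (random_ap p n) {X. \<forall>j\<in>{1..p}. X j \<in> S j - S' j} = 0)"
        using small[rule_format, OF conjI[OF \<mu>]] by blast
      show ?thesis
      proof (intro exI[of _ n0] allI impI, elim conjE)
        fix n and S :: "nat \<Rightarrow> (nat \<Rightarrow> int) set"
        assume n: "n \<ge> n0" and sym: "\<forall>j\<in>{1..p}. symmetric_set p n (S j)"
          and prob: "measure_pmf.prob (random_ap p n) {X. \<forall>j\<in>{1..p}. X j \<in> S j} < \<mu> powr C"
        show "\<exists>S'. (\<forall>j\<in>{1..p}. symmetric_set p n (S' j) \<and> set_density p n (S' j) \<le> \<mu>) \<and>
            measure_pmf.prob (random_ap p n) {X. \<forall>j\<in>{1..p}. X j \<in> S j - S' j} = 0"
          by (rule n0[OF n sym less_le_trans[OF prob le]])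
      qed
    qed
  qed
qed

end
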